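(* Let $T=\{z\in\mathbb{C}:|z|=1\}$, let $\Delta=\{z\in\mathbb{C}:|z|<1\}$, and let $E\subseteq T$ be a set. Then the following are equivalent: (a) there exists a Blaschke product $B$ on $\Delta$ such that for every $\zeta\in E$ the radial limit $\lim_{r\to 1^-}B(r\zeta)$ does not exist, and for every $\zeta\in T\setminus E$ the unrestricted limit $\lim_{z\to\zeta,\ z\in\Delta}B(z)$ exists; (b) $E$ is a closed subset of $T$ and $m(E)=0$, where $m$ is Lebesgue measure on $T$.
   Context: A Blaschke product is a function on the open unit disk $\Delta$ of the form $B(z)=c\,z^{k}\prod_{n}\frac{|a_n|}{a_n}\frac{a_n-z}{1-\overline{a_n}z}$, where $|c|=1$, $k\ge 0$ is an integer, and $\{a_n\}\subset\Delta\setminus\{0\}$ is a finite (possibly empty) or infinite sequence (repetitions allowed) with $\sum_n(1-|a_n|)<\infty$; thus both finite and infinite Blaschke products are allowed. The radial limit of $f:\Delta\to\mathbb{C}$ at $\zeta\in T$ is $\lim_{r\to1^-}f(r\zeta)$, if it exists in $\mathbb{C}$. The unrestricted limit of $f$ at $\zeta\in T$ is the limit of $f(z)$ as $z\in\Delta$ approaches $\zeta$ arbitrarily (with no restriction on the manner of approach within $\Delta$), if it exists in $\mathbb{C}$. *)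

theory Defs
  imports "HOL-Complex_Analysis.Complex_Analysis" "HOL-Library.Extended_Nat"
begin

definition blaschke_factor :: "complex \<Rightarrow> complex \<Rightarrow> complex" where
  "blaschke_factor a z = (complex_of_real (cmod a) / a) * ((a - z) / (1 - cnj a * z))"

(* The zeros away from the origin are the a n with n < N; the sequence is finite
   (possibly empty) for N < infinity and infinite for N = infinity. Beyond N the product is
   padded with 1 and the sum with 0. For cmod z < 1 the summability condition makes the product
   converge (lemma blaschke_convergent_prod), also when some factors vanish at z, so prodinf
   is its value. Only the values of B on the open unit disk are constrained. *)
definition blaschke_product :: "(complex \<Rightarrow> complex) \<Rightarrow> bool" where
  "blaschke_product B \<longleftrightarrow>
     (\<exists>(c::complex) (k::nat) (N::enat) (a::nat \<Rightarrow> complex).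
        cmod c = 1 \<and>
        (\<forall>n. enat n < N \<longrightarrow> a n \<in> ball 0 1 - {0}) \<and>
        summable (\<lambda>n. if enat n < N then 1 - cmod (a n) else 0) \<and>
        (\<forall>z\<in>ball 0 1.
           B z = c * z ^ k * (\<Prod>n. if enat n < N then blaschke_factor (a n) z else 1)))"

definition has_radial_limit :: "(complex \<Rightarrow> complex) \<Rightarrow> complex \<Rightarrow> bool" where
  "has_radial_limit f \<zeta> \<longleftrightarrow>
     (\<exists>L. ((\<lambda>r::real. f (complex_of_real r * \<zeta>)) \<longlongrightarrow> L) (at_left 1))"

definition has_unrestricted_limit :: "(complex \<Rightarrow> complex) \<Rightarrow> complex \<Rightarrow> bool" where
  "has_unrestricted_limit f \<zeta> \<longleftrightarrow> (\<exists>L. (f \<longlongrightarrow> L) (at \<zeta> within ball 0 1))"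

(* Arc length, total mass 2 * pi. *)
definition circle_lebesgue :: "complex measure" where
  "circle_lebesgue =
     completion (distr (restrict_space lborel {0..<2 * pi}) (restrict_space borel (sphere 0 1)) cis)"

lemma cis_measurable_circle:
  "cis \<in> measurable (restrict_space lborel {0..<2 * pi}) (restrict_space borel (sphere 0 1))"
proof -
  have "cis \<in> borel_measurable borel"
    by (intro borel_measurable_continuous_onI continuous_intros)
  then have "cis \<in> borel_measurable lborel" by simp
  then have "cis \<in> borel_measurable (restrict_space lborel {0..<2 * pi})"
    by (rule measurable_restrict_space1)
  then show ?thesis
    by (intro measurable_restrict_space2) auto
qed

lemma blaschke_convergent_prod:
  fixes a :: "nat \<Rightarrow> complex" and N :: enat
  assumes a: "\<And>n. enat n < N \<Longrightarrow> a n \<in> ball 0 1 - {0}"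
    and s: "summable (\<lambda>n. if enat n < N then 1 - cmod (a n) else 0)"
    and z: "z \<in> ball 0 1"
  shows "convergent_prod (\<lambda>n. if enat n < N then blaschke_factor (a n) z else 1)"
proof -
  have bound: "cmod (blaschke_factor w z - 1) \<le> (2 / (1 - cmod z)) * (1 - cmod w)"
    if w: "w \<in> ball 0 1 - {0}" for w
  proof -
    have nz: "w \<noteq> 0" "cmod w < 1" "cmod z < 1" using w z by auto
    have d: "cmod (1 - cnj w * z) \<ge> 1 - cmod z"
    proof -
      have "cmod (cnj w * z) \<le> cmod z"
        using nz by (simp add: norm_mult mult_left_le_one_le)
      moreover have "1 - cmod (cnj w * z) \<le> cmod (1 - cnj w * z)"
        using norm_triangle_ineq2[of 1 "cnj w * z"] by simp
      ultimately show ?thesis by linarith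
    qed
    then have d0: "1 - cnj w * z \<noteq> 0" using nz by auto
    have sq: "w * cnj w = complex_of_real (cmod w) * complex_of_real (cmod w)"
      using complex_norm_square[of w] by (simp add: power2_eq_square)
    have "(blaschke_factor w z - 1) * (w * (1 - cnj w * z)) =
            of_real (cmod w) * (w - z) - w * (1 - cnj w * z)"
      using d0 nz(1) by (simp add: blaschke_factor_def field_simps)
    also have "\<dots> = of_real (cmod w) * (w - z) - w + (w * cnj w) * z"
      by (simp add: algebra_simps)
    also have "\<dots> = - of_real (1 - cmod w) * (w + of_real (cmod w) * z)"
      unfolding sq by (simp add: algebra_simps)
    finally have "cmod ((blaschke_factor w z - 1) * (w * (1 - cnj w * z))) =
        cmod (- of_real (1 - cmod w) * (w + of_real (cmod w) * z))"
      by (rule arg_cong)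
    then have e: "cmod (blaschke_factor w z - 1) * (cmod w * cmod (1 - cnj w * z)) =
        (1 - cmod w) * cmod (w + of_real (cmod w) * z)"
      using nz(2) by (simp only: norm_mult norm_minus_cancel norm_of_real)
    have "cmod (w + of_real (cmod w) * z) \<le> cmod w + cmod w * cmod z"
      using norm_triangle_ineq[of w "of_real (cmod w) * z"] by (simp add: norm_mult)
    also have "\<dots> \<le> cmod w * 2" using nz by (simp add: algebra_simps)
    finally have "cmod (blaschke_factor w z - 1) * (cmod w * cmod (1 - cnj w * z)) \<le>
        (1 - cmod w) * (cmod w * 2)"
      unfolding e using nz by (intro mult_left_mono) auto
    then have "cmod w * (cmod (blaschke_factor w z - 1) * cmod (1 - cnj w * z)) \<le>
        cmod w * (2 * (1 - cmod w))" by (simp add: mult_ac)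
    then have "cmod (blaschke_factor w z - 1) * cmod (1 - cnj w * z) \<le> 2 * (1 - cmod w)"
      using nz(1) by simp
    moreover have "cmod (blaschke_factor w z - 1) * (1 - cmod z) \<le>
        cmod (blaschke_factor w z - 1) * cmod (1 - cnj w * z)"
      using d by (intro mult_left_mono) auto
    ultimately show ?thesis using nz(3) by (simp add: pos_le_divide_eq)
  qed
  have "summable (\<lambda>n. cmod ((if enat n < N then blaschke_factor (a n) z else 1) - 1))"
  proof (rule summable_comparison_test')
    show "summable (\<lambda>n. (2 / (1 - cmod z)) * (if enat n < N then 1 - cmod (a n) else 0))"
      using s by (rule summable_mult)
    show "norm (cmod ((if enat n < N then blaschke_factor (a n) z else 1) - 1)) \<le>
        (2 / (1 - cmod z)) * (if enat n < N then 1 - cmod (a n) else 0)" if "n \<ge> 0" for n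
      using bound[OF a, of n] by simp
  qed
  then show ?thesis
    using abs_convergent_prod_conv_summable abs_convergent_prod_imp_convergent_prod by blast
qed

end

theory Submission
  imports Defs
begin

text \<open>
  Necessity. Let \<open>G\<^sub>m\<close> be the product of the factors from the \<open>m\<close>-th on. Since \<open>\<bar>G\<^sub>m\<bar> \<le> 1\<close>, the
  mean of \<open>\<bar>1 - G\<^sub>m\<bar>\<^sup>2\<close> over a circle is at most \<open>2 (1 - Re G\<^sub>m(0))\<close>, which tends to \<open>0\<close>. A weak type
  estimate for the radial maximal function (Poisson kernel and Vitali covering) turns this into
  uniform smallness of \<open>1 - G\<^sub>m\<close> along almost all radii, so that \<open>B\<close> has radial limits of modulus 1
  almost everywhere and \<open>E\<close> is null. For the same reason an unrestricted limit has modulus 1, so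
  the zeros stay away from a point outside \<open>E\<close>, and then the product converges uniformly up to the
  boundary near that point; hence the complement of \<open>E\<close> is open.

  Sufficiency. Cover the closed null set \<open>E\<close> by finitely many arcs of small total length and put a
  zero at height equal to the half-length above the centre of each arc, so that \<open>\<bar>B\<bar> \<le> 2/3\<close> somewhere
  on every radius ending in \<open>E\<close>. The finite product built so far has modulus close to 1 on a circle
  close to the boundary; if the next zeros are much closer to the boundary than this circle, they do
  not spoil it, and \<open>\<bar>B\<bar> \<ge> 49/64 > 2/3\<close> on it. Iterating, \<open>\<bar>B\<bar>\<close> oscillates along these radii.
\<close>

section \<open>A weak type estimate for the radial maximal function\<close>

definition poisson_kernel :: "real \<Rightarrow> real \<Rightarrow> real" where
  "poisson_kernel r t = (1 - r\<^sup>2) / (1 - 2 * r * cos t + r\<^sup>2)"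

text \<open>The expression is |1 - r e^(it)|^2; since \<open>cos t \<le> 1\<close>, it is at least
  \<open>(1 - r)\<^sup>2\<close>.\<close>

lemma poisson_denominator_pos:
  fixes r t :: real
  assumes "0 \<le> r" "r < 1"
  shows "1 - 2 * r * cos t + r\<^sup>2 > 0"
proof -
  have "r * cos t \<le> r * 1"
    using assms(1) by (intro mult_left_mono cos_le_one)
  moreover have "(1 - r)\<^sup>2 > 0" using assms by simp
  ultimately show ?thesis by (simp add: power2_eq_square algebra_simps)
qed

lemma poisson_kernel_nonneg:
  assumes "0 \<le> r" "r < 1"
  shows "poisson_kernel r t \<ge> 0"
proof -
  have "r\<^sup>2 \<le> 1" using assms by (simp add: power_le_one)
  then show ?thesis
    using poisson_denominator_pos[OF assms, of t] by (simp add: poisson_kernel_def)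
qed

lemma continuous_on_poisson_kernel:
  assumes "0 \<le> r" "r < 1"
  shows "continuous_on A (poisson_kernel r)"
  unfolding poisson_kernel_def
  using poisson_denominator_pos[OF assms] by (intro continuous_intros) (metis less_irrefl)

lemma poisson_kernel_minus [simp]: "poisson_kernel r (- t) = poisson_kernel r t"
  by (simp add: poisson_kernel_def)

text \<open>With u = e^(it), the form (1 - r^2) / ((1 - r u) (u - r)) du equals i P_r(t) dt, so this
  is Cauchy's formula for g(u) (1 - r^2) / (1 - r u). A point \<open>r\<close> of the real axis is
  enough, since other points are reached by rotating \<open>g\<close>.\<close>

lemma poisson_integral:
  fixes g :: "complex \<Rightarrow> complex"
  assumes g: "g holomorphic_on cball 0 1" and r: "0 \<le> r" "r < 1"
  shows "((\<lambda>t. g (cis t) * of_real (poisson_kernel r t)) has_integral 2 * of_real pi * g (of_real r)) {-pi..pi}"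
proof -
  \<comment> \<open>Cauchy's formula at \<open>-r\<close>; reflecting \<open>g\<close> lets the shift by \<open>\<pi>\<close> move \<open>[0, 2\<pi>]\<close> to \<open>[-\<pi>, \<pi>]\<close>.\<close>
  define h where "h u = g (- u) * (1 - (of_real r)\<^sup>2) / (1 + of_real r * u)" for u
  have nz: "1 + of_real r * u \<noteq> 0" if "cmod u \<le> 1" for u
  proof
    assume "1 + of_real r * u = 0"
    then have "cmod (of_real r * u) = 1"
      by (metis add_eq_0_iff norm_minus_cancel norm_one)
    moreover have "cmod (of_real r * u) \<le> r * 1"
      using that r by (simp add: norm_mult mult_left_le)
    ultimately show False using r by simp
  qed
  have "(g \<circ> uminus) holomorphic_on cball 0 1"
    by (intro holomorphic_on_compose_gen[OF _ g] holomorphic_intros) auto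
  then have "h holomorphic_on cball 0 1"
    unfolding h_def comp_def using nz by (intro holomorphic_intros) auto
  from Cauchy_integral_circlepath_simple[OF this, of "- of_real r"]
  have "((\<lambda>u. h u / (u + of_real r)) has_contour_integral (2 * of_real pi * \<i> * h (- of_real r))) (circlepath 0 1)"
    using r by simp
  then have "((\<lambda>t. h (cis t) / (cis t + of_real r) * \<i> * cis t) has_integral
      2 * of_real pi * \<i> * h (- of_real r)) {0..2 * pi}"
    unfolding circlepath_def by (subst (asm) has_contour_integral_part_circlepath_iff) auto
  from has_integral_shift_real_ivl[OF this, of pi]
  have "((\<lambda>t. h (- cis t) / (- cis t + of_real r) * \<i> * (- cis t)) has_integral
      2 * of_real pi * \<i> * h (- of_real r)) {-pi..pi}"
    by (simp add: cis_mult[symmetric])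
  from has_integral_mult_right[OF this, of "- \<i>"]
  have *: "((\<lambda>t. - \<i> * (h (- cis t) / (- cis t + of_real r) * \<i> * (- cis t))) has_integral
      2 * of_real pi * h (- of_real r)) {-pi..pi}"
    by (simp add: algebra_simps)
  have "(1::complex) - (of_real r)\<^sup>2 \<noteq> 0"
    using nz[of "- of_real r"] r by (simp add: power2_eq_square)
  then have "h (- of_real r) = g (of_real r)"
    by (simp add: h_def power2_eq_square)
  moreover have "- \<i> * (h (- cis t) / (- cis t + of_real r) * \<i> * (- cis t)) =
      g (cis t) * of_real (poisson_kernel r t)" for t
  proof -
    have n1: "1 - of_real r * cis t \<noteq> 0" using nz[of "- cis t"] by simp
    have n2: "cis t - of_real r \<noteq> 0" using r
      by (metis abs_of_nonneg eq_iff_diff_eq_0 less_irrefl norm_cis norm_of_real)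
    \<comment> \<open>For |u| = 1, u - r = u conj(1 - r u), so the product is u |1 - r u|^2, that
      is, u times the Poisson denominator.\<close>
    have e: "(1 - of_real r * cis t) * (cis t - of_real r) =
        cis t * of_real (1 - 2 * r * cos t + r\<^sup>2)"
    proof -
      have 1: "cis t * cis t + 1 = 2 * of_real (cos t) * cis t"
        using sin_cos_squared_add[of t]
        by (auto simp: complex_eq_iff power2_eq_square algebra_simps)
      have "(1 - of_real r * cis t) * (cis t - of_real r) = 
         cis t * (1 + of_real (r\<^sup>2)) - of_real r * (cis t * cis t + 1)"
        by (simp add: algebra_simps power2_eq_square)
      also have "\<dots> = cis t * of_real (1 - 2 * r * cos t + r\<^sup>2)"
        unfolding 1 by (simp add: algebra_simps)
      finally show ?thesis .
    qed
    have "- \<i> * (h (- cis t) / (- cis t + of_real r) * \<i> * (- cis t)) =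
        g (cis t) * (1 - (of_real r)\<^sup>2) * cis t / ((1 - of_real r * cis t) * (cis t - of_real r))"
      using n1 n2 by (simp add: h_def divide_simps) (simp add: algebra_simps)
    also have "\<dots> = g (cis t) * of_real (poisson_kernel r t)"
      unfolding e by (simp add: poisson_kernel_def)
    finally show ?thesis .
  qed
  ultimately show ?thesis using * by simp
qed

lemma poisson_kernel_has_integral:
  assumes "0 \<le> r" "r < 1"
  shows "(poisson_kernel r has_integral 2 * pi) {-pi..pi}"
proof -
  have "((\<lambda>t. complex_of_real (poisson_kernel r t)) has_integral of_real (2 * pi)) {-pi..pi}"
    using poisson_integral[of "\<lambda>_. 1" r] assms by simp
  from has_integral_linear[OF this bounded_linear_Re] show ?thesis by (simp add: comp_def)
qed

text \<open>Being even and decreasing on [0, pi], the kernel is a mixture of normalized indicators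
  of symmetric intervals. A common bound for the averages of \<open>F\<close> over such intervals
  therefore bounds its mean against the kernel, whose total mass is 2 pi.\<close>

lemma poisson_integral_le_of_averages_le:
  fixes F :: "real \<Rightarrow> real"
  assumes F: "continuous_on {-pi..pi} F" and r: "0 \<le> r" "r < 1"
    and avg: "\<And>h. 0 < h \<Longrightarrow> h \<le> pi \<Longrightarrow> integral {-h..h} F \<le> 2 * h * c"
  shows "integral {-pi..pi} (\<lambda>t. poisson_kernel r t * F t) \<le> 2 * pi * c"
proof -
  let ?P = "poisson_kernel r"
  \<comment> \<open>In terms of \<open>Q\<close> the hypothesis says that integrals over symmetric
    intervals are nonnegative, and the goal is that the integral of \<open>Q\<close> against the
    kernel is nonnegative.\<close>
  define Q where "Q t = c - F t" for t
  have contQ: "continuous_on {-pi..pi} Q"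
    unfolding Q_def by (intro continuous_intros F)
  have contPQ: "continuous_on {-pi..pi} (\<lambda>t. ?P t * Q t)"
    by (intro continuous_intros contQ continuous_on_poisson_kernel r)
  define G where "G x = integral {-pi..x} Q" for x
  define H where "H x = integral {-pi..x} (\<lambda>t. ?P t * Q t)" for x
  have dG: "(G has_real_derivative Q x) (at x)" if "-pi < x" "x < pi" for x
    using integral_has_real_derivative[OF contQ, of x] that
    by (simp add: G_def[abs_def] at_within_Icc_at)
  have dH: "(H has_real_derivative ?P x * Q x) (at x)" if "-pi < x" "x < pi" for x
    using integral_has_real_derivative[OF contPQ, of x] that
    by (simp add: H_def[abs_def] at_within_Icc_at)
  have contG: "continuous_on {-pi..pi} G" and contH: "continuous_on {-pi..pi} H"
    unfolding G_def H_def
    by (intro indefinite_integral_continuous_1 integrable_continuous_real contQ contPQ)+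
  have Gdiff: "G h - G (-h) \<ge> 0" if "0 < h" "h \<le> pi" for h
  proof -
    have sub: "{-h..h} \<subseteq> {-pi..pi}" using that by auto
    have "integral {-pi..-h} Q + integral {-h..h} Q = integral {-pi..h} Q"
      using that by (intro Henstock_Kurzweil_Integration.integral_combine
          integrable_continuous_real continuous_on_subset[OF contQ]) auto
    moreover have "integral {-h..h} Q = 2 * h * c - integral {-h..h} F"
      unfolding Q_def using that
      by (subst integral_diff) (auto intro!: integrable_continuous_real continuous_on_subset[OF F])
    ultimately show ?thesis using avg[OF that] by (simp add: G_def)
  qed
  \<comment> \<open>Integration by parts in disguise: the derivative of \<open>D\<close> is \<open>- P' (G h - G (-h))\<close>, and the
    Poisson kernel decreases on \<open>[0, \<pi>]\<close>.\<close>
  define D where "D h = (H h - H (-h)) - ?P h * (G h - G (-h))" for h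
  have "D 0 \<le> D pi"
  proof (rule DERIV_nonneg_imp_increasing_open[of 0 pi D])
    fix x :: real assume x: "0 < x" "x < pi"
    define P' where "P' = - (1 - r\<^sup>2) * (2 * r * sin x) / (1 - 2 * r * cos x + r\<^sup>2)\<^sup>2"
    have dP: "(?P has_real_derivative P') (at x)"
      unfolding poisson_kernel_def[abs_def] P'_def
      using poisson_denominator_pos[OF r, of x]
      by (auto intro!: derivative_eq_intros simp: power2_eq_square minus_divide_left algebra_simps)
    have "P' \<le> 0"
    proof -
      have "r\<^sup>2 \<le> 1" using r by (simp add: power_le_one)
      moreover have "sin x \<ge> 0" using x by (simp add: sin_ge_zero)
      ultimately show ?thesis using r
        by (auto simp: P'_def intro!: divide_nonpos_nonneg mult_nonpos_nonneg)
    qed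
    have dGm: "((\<lambda>h. G (-h)) has_real_derivative - Q (-x)) (at x)"
      using DERIV_mirror[where f=G and x=x and y="Q (-x)"] dG[of "-x"] x by simp
    have dHm: "((\<lambda>h. H (-h)) has_real_derivative - (?P x * Q (-x))) (at x)"
      using DERIV_mirror[where f=H and x=x and y="?P (-x) * Q (-x)"] dH[of "-x"] x by simp
    have "(D has_real_derivative - P' * (G x - G (-x))) (at x)"
      unfolding D_def[abs_def]
      by (rule DERIV_cong[OF DERIV_diff[OF DERIV_diff[OF dH dHm] DERIV_mult[OF dP DERIV_diff[OF dG dGm]]]])
        (use x in \<open>auto simp: algebra_simps\<close>)
    moreover have "- P' * (G x - G (-x)) \<ge> 0"
      using \<open>P' \<le> 0\<close> Gdiff[of x] x by (simp add: mult_nonpos_nonneg)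
    ultimately show "\<exists>y. (D has_real_derivative y) (at x) \<and> 0 \<le> y" by blast
  next
    have m: "continuous_on {0..pi} (\<lambda>h. G (-h))" "continuous_on {0..pi} (\<lambda>h. H (-h))"
      by (rule continuous_on_compose2[OF contG], (auto intro!: continuous_intros)[2],
          rule continuous_on_compose2[OF contH], (auto intro!: continuous_intros)[2])
    show "continuous_on {0..pi} D"
      unfolding D_def
      by (intro continuous_intros m continuous_on_poisson_kernel r
          continuous_on_subset[OF contG] continuous_on_subset[OF contH]) auto
  qed auto
  moreover have "?P pi * (G pi - G (-pi)) \<ge> 0"
    using Gdiff[of pi] poisson_kernel_nonneg[OF r] by simp
  \<comment> \<open>Here \<open>D 0 = 0\<close> and \<open>H (-pi) = 0\<close>, so
    \<open>D pi \<ge> 0\<close> bounds \<open>H pi\<close> below by the nonnegative boundary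
    term.\<close>
  ultimately have "H pi \<ge> 0" by (simp add: D_def H_def)
  moreover have "H pi = 2 * pi * c - integral {-pi..pi} (\<lambda>t. ?P t * F t)"
  proof -
    have 1: "((\<lambda>t. ?P t * c) has_integral 2 * pi * c) {-pi..pi}"
      by (intro has_integral_mult_left poisson_kernel_has_integral r)
    have 2: "(\<lambda>t. ?P t * F t) integrable_on {-pi..pi}"
      by (intro integrable_continuous_real continuous_intros F continuous_on_poisson_kernel r)
    show ?thesis
      unfolding H_def Q_def using integral_diff[OF has_integral_integrable[OF 1] 2] 
      by (simp add: integral_unique[OF poisson_kernel_has_integral[OF r]] right_diff_distrib)
  qed
  ultimately show ?thesis by simp
qed

section \<open>Vitali covering and maximal functions\<close>

lemma vitali_compact_real:
  fixes r :: "real \<Rightarrow> real"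
  assumes K: "compact K" and r: "\<And>x. x \<in> K \<Longrightarrow> 0 < r x"
  obtains C where "finite C" "C \<subseteq> K"
    "pairwise (\<lambda>x y. disjnt (ball x (r x)) (ball y (r y))) C"
    "K \<subseteq> (\<Union>x\<in>C. ball x (5 * r x))"
proof -
  have "K \<subseteq> (\<Union>x\<in>K. ball x (r x))"
    using r by force
  with K obtain D where D: "D \<subseteq> K" "finite D" "K \<subseteq> (\<Union>x\<in>D. ball x (r x))"
    using compactE_image[OF K, of K "\<lambda>x. ball x (r x)"] by (metis open_ball)
  \<comment> \<open>Vitali's lemma requires bounded radii; passing to the finite subcover
    \<open>D\<close> first provides the bound and makes the selected family finite.\<close>
  define b where "b = Max (insert 1 (r ` D))"
  have "0 < r x \<and> r x \<le> b" if "x \<in> D" for x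
    using that D r by (auto simp: b_def)
  then obtain C where "countable C" "C \<subseteq> D"
     "pairwise (\<lambda>i j. disjnt (ball i (r i)) (ball j (r j))) C" 
     "K \<subseteq> (\<Union>i\<in>C. ball i (5 * r i))"
    using Vitali_covering_lemma_balls[OF D(3), of b thesis] by blast
  with D show ?thesis
    by (intro that[of C]) (auto intro: finite_subset)
qed

text \<open>Weak type (1,1) bound: the selected intervals are disjoint and each carries mass more
  than \<open>2 * h x * l\<close>, while their fivefold enlargements, of length
  \<open>10 * h x\<close>, cover \<open>K\<close>. The intervals may leave \<open>{a..b}\<close> by
  at most \<open>d\<close>, hence the larger domain of integration.\<close>

lemma hardy_littlewood_compact:
  fixes F :: "real \<Rightarrow> real"
  assumes K: "compact K" "K \<subseteq> {a..b}" and l: "l > 0" and F: "continuous_on UNIV F" "\<And>t. F t \<ge> 0"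
    and big: "\<And>x. x \<in> K \<Longrightarrow> \<exists>h. 0 < h \<and> h \<le> d \<and> integral {x-h..x+h} F > 2 * h * l"
  shows "measure lebesgue K \<le> 5 / l * integral {a-d..b+d} F"
proof -
  obtain h where h: "0 < h x" "h x \<le> d" "integral {x - h x..x + h x} F > 2 * h x * l" if "x \<in> K" for x
    using big by metis
  obtain C where C: "finite C" "C \<subseteq> K"
    "pairwise (\<lambda>x y. disjnt (ball x (h x)) (ball y (h y))) C"
    "K \<subseteq> (\<Union>x\<in>C. ball x (5 * h x))"
    by (rule vitali_compact_real[OF K(1), of h]) (use h(1) in auto)
  have int: "F integrable_on {u..v}" for u v
    by (intro integrable_continuous_real continuous_on_subset[OF F(1)]) auto
  have "measure lebesgue K \<le> measure lebesgue (\<Union>x\<in>C. ball x (5 * h x))"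
    using C K by (intro measure_mono_fmeasurable) (auto intro!: fmeasurable.finite_UN simp: lmeasurable_compact fmeasurableD)
  also have "\<dots> \<le> (\<Sum>x\<in>C. measure lebesgue (ball x (5 * h x)))"
    using C by (intro measure_UNION_le) auto
  also have "\<dots> = (\<Sum>x\<in>C. 10 * h x)"
    using C h(1) by (intro sum.cong) (auto simp: ball_eq_greaterThanLessThan subset_iff less_imp_le)
  also have "\<dots> \<le> (\<Sum>x\<in>C. 5 / l * integral {x - h x..x + h x} F)"
    using C h l by (intro sum_mono) (force simp: field_simps)
  also have "\<dots> = 5 / l * (\<Sum>x\<in>C. integral {x - h x..x + h x} F)"
    by (simp add: sum_distrib_left)
  also have "\<dots> \<le> 5 / l * integral {a-d..b+d} F"
  proof (intro mult_left_mono)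
    have *: "(F has_integral (\<Sum>x\<in>C. integral {x - h x..x + h x} F)) (\<Union>x\<in>C. ball x (h x))"
    proof (rule has_integral_UN)
      show "pairwise (\<lambda>i i'. negligible (ball i (h i) \<inter> ball i' (h i'))) C"
        using C(3) by (auto simp: pairwise_def disjnt_def)
      show "(F has_integral integral {x - h x..x + h x} F) (ball x (h x))" for x
        using integrable_integral[OF int] 
        by (simp add: ball_eq_greaterThanLessThan flip: has_integral_Icc_iff_Ioo)
    qed (use C in auto)
    have "ball x (h x) \<subseteq> {a-d..b+d}" if "x \<in> C" for x
    proof -
      have "x \<in> {a..b}" "h x \<le> d" using that C K h by auto
      then show ?thesis by (auto simp: ball_eq_greaterThanLessThan)
    qed
    then show "(\<Sum>x\<in>C. integral {x - h x..x + h x} F) \<le> integral {a-d..b+d} F"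
      using has_integral_subset_le[OF _ * integrable_integral[OF int]] F(2) by blast
  qed (use l in auto)
  finally show ?thesis .
qed

text \<open>Subharmonicity of |g|^2: Poisson's formula for g^2, then the triangle inequality for
  integrals.\<close>

lemma norm_square_le_poisson_integral:
  fixes g :: "complex \<Rightarrow> complex"
  assumes g: "g holomorphic_on cball 0 1" and r: "0 \<le> r" "r < 1"
  shows "2 * pi * (cmod (g (of_real r)))\<^sup>2 \<le> integral {-pi..pi} (\<lambda>t. poisson_kernel r t * (cmod (g (cis t)))\<^sup>2)"
proof -
  have "(\<lambda>z. (g z)\<^sup>2) holomorphic_on cball 0 1" by (intro holomorphic_intros g)
  note I = poisson_integral[OF this r]
  have cont: "continuous_on {-pi..pi} (\<lambda>t. g (cis t))"
    by (rule continuous_on_compose2[OF holomorphic_on_imp_continuous_on[OF g]])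
      (auto intro!: continuous_intros)
  have "norm (integral {-pi..pi} (\<lambda>t. (g (cis t))\<^sup>2 * of_real (poisson_kernel r t)))
    \<le> integral {-pi..pi} (\<lambda>t. poisson_kernel r t * (cmod (g (cis t)))\<^sup>2)"
  proof (rule integral_norm_bound_integral)
    show "(\<lambda>t. poisson_kernel r t * (cmod (g (cis t)))\<^sup>2) integrable_on {-pi..pi}"
      by (intro integrable_continuous_real continuous_intros cont continuous_on_poisson_kernel r)
    show "norm ((g (cis t))\<^sup>2 * of_real (poisson_kernel r t)) \<le> poisson_kernel r t * (cmod (g (cis t)))\<^sup>2" for t
      using poisson_kernel_nonneg[OF r, of t] by (simp add: norm_mult norm_power)
  qed (use I in auto)
  then show ?thesis
    by (simp add: integral_unique[OF I] norm_mult norm_power)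
qed

text \<open>By compactness finitely many \<open>s\<close> witness all points of \<open>K\<close>, so
  one circle of radius \<rho> < 1 outside all of them can serve as boundary. A large value inside
  this circle forces a large average of |f|^2 over some arc centred on the same radius. Arcs of
  half-length up to pi about points of [0, 2 pi] explain the range from -pi to 3 pi.\<close>

lemma radial_maximal_compact:
  fixes f :: "complex \<Rightarrow> complex"
  assumes f: "f holomorphic_on ball 0 1" and l: "l > 0"
    and M: "\<And>\<rho>. 0 < \<rho> \<Longrightarrow> \<rho> < 1 \<Longrightarrow> integral {-pi..3*pi} (\<lambda>t. (cmod (f (of_real \<rho> * cis t)))\<^sup>2) \<le> M"
    and K: "compact K" "K \<subseteq> {0..2*pi}"
    and big: "\<And>x. x \<in> K \<Longrightarrow> \<exists>s\<in>{0..<1}. (cmod (f (of_real s * cis x)))\<^sup>2 > l"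
  shows "measure lebesgue K \<le> 5 / l * M"
proof -
  have contf: "continuous_on (ball 0 1) f"
    using f holomorphic_on_imp_continuous_on by blast
  have contc: "continuous_on A (\<lambda>x. f (of_real s * cis x))" if "s \<in> {0..<1}" for s A
    by (rule continuous_on_compose2[OF contf]) (use that in \<open>auto intro!: continuous_intros simp: norm_mult\<close>)
  define U where "U s = {x. (cmod (f (of_real s * cis x)))\<^sup>2 > l}" for s
  have "K \<subseteq> (\<Union>s\<in>{0..<1}. U s)" using big by (force simp: U_def)
  moreover have "open (U s)" if "s \<in> {0..<1}" for s
    unfolding U_def by (intro open_Collect_less continuous_intros contc that)
  ultimately obtain D where D: "D \<subseteq> {0..<1}" "finite D" "K \<subseteq> (\<Union>s\<in>D. U s)"
    using compactE_image[OF K(1), of "{0..<1}" U] by metis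
  \<comment> \<open>Inserting 0 covers an empty \<open>D\<close> and ensures that the radius \<rho>
    chosen next is positive.\<close>
  define \<rho>0 where "\<rho>0 = Max (insert 0 D)"
  have "\<rho>0 \<in> insert 0 D" unfolding \<rho>0_def using D by (intro Max_in) auto
  then have \<rho>0: "\<rho>0 < 1" using D by auto
  have D\<rho>0: "s \<le> \<rho>0" if "s \<in> insert 0 D" for s using that D by (simp add: \<rho>0_def)
  define \<rho> where "\<rho> = (\<rho>0 + 1) / 2"
  have \<rho>: "0 < \<rho>" "\<rho>0 < \<rho>" "\<rho> < 1" using \<rho>0 D\<rho>0[of 0] by (auto simp: \<rho>_def)
  define F where "F t = (cmod (f (of_real \<rho> * cis t)))\<^sup>2" for t
  have contF: "continuous_on A F" for A
    unfolding F_def using \<rho> by (intro continuous_intros contc) auto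
  have "measure lebesgue K \<le> 5 / l * integral {0-pi..2*pi+pi} F"
  proof (rule hardy_littlewood_compact[OF K l contF])
    fix x assume "x \<in> K"
    then obtain s where s: "s \<in> D" "(cmod (f (of_real s * cis x)))\<^sup>2 > l" using D by (auto simp: U_def)
    then have s': "0 \<le> s" "s < \<rho>" using D D\<rho>0[of s] \<rho> by auto
    show "\<exists>h. 0 < h \<and> h \<le> pi \<and> integral {x-h..x+h} F > 2 * h * l"
    proof (rule ccontr)
      assume "\<not> ?thesis"
      then have avg: "integral {x-h..x+h} F \<le> 2 * h * l" if "0 < h" "h \<le> pi" for h
        using that by force
      \<comment> \<open>Rotating and rescaling moves the circle of radius \<rho> to the unit circle
        and the point under consideration to the real number \<open>s / \<rho>\<close>.\<close>
      define g where "g z = f (of_real \<rho> * cis x * z)" for z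
      have g: "g holomorphic_on cball 0 1"
        unfolding g_def
      proof (rule holomorphic_on_compose_gen[OF _ f, unfolded comp_def])
        show "(\<lambda>z. of_real \<rho> * cis x * z) ` cball 0 1 \<subseteq> ball 0 1"
        proof clarsimp
          fix z :: complex assume "cmod z \<le> 1"
          then have "\<rho> * cmod z \<le> \<rho>" using \<rho>(1) by (simp add: mult_left_le)
          then have "\<rho> * cmod z < 1" using \<rho>(3) by linarith
          then show "cmod (of_real \<rho> * cis x * z) < 1" using \<rho>(1) by (simp add: norm_mult)
        qed
      qed (intro holomorphic_intros)
      have gF: "(cmod (g (cis t)))\<^sup>2 = F (x + t)" for t
        by (simp add: g_def F_def cis_mult mult.assoc)
      have r: "0 \<le> s / \<rho>" "s / \<rho> < 1" using s' \<rho> by auto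
      have "2 * pi * (cmod (g (of_real (s / \<rho>))))\<^sup>2 \<le>
          integral {-pi..pi} (\<lambda>t. poisson_kernel (s / \<rho>) t * F (x + t))"
        using norm_square_le_poisson_integral[OF g r] by (simp add: gF)
      also have "\<dots> \<le> 2 * pi * l"
      proof (rule poisson_integral_le_of_averages_le[OF _ r])
        show "continuous_on {-pi..pi} (\<lambda>t. F (x + t))"
          by (rule continuous_on_compose2[OF contF[of UNIV]]) (auto intro!: continuous_intros)
        show "integral {-h..h} (\<lambda>t. F (x + t)) \<le> 2 * h * l" if "0 < h" "h \<le> pi" for h
          using avg[OF that] integral_shift_Icc_real[of "-h" h F x] by (simp add: comp_def add.commute)
      qed
      finally have "(cmod (g (of_real (s / \<rho>))))\<^sup>2 \<le> l" by simp
      moreover have "g (of_real (s / \<rho>)) = f (of_real s * cis x)"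
        using \<rho> by (simp add: g_def mult.commute)
      ultimately show False using s by simp
    qed
  qed (auto simp: F_def)
  also have "\<dots> \<le> 5 / l * M"
    using M[OF \<rho>(1,3)] l by (intro mult_left_mono) (auto simp: F_def[abs_def])
  finally show ?thesis .
qed

text \<open>The exceptional set is relatively open in [0, 2 pi], hence measurable, and inner
  regularity carries the bound over from its compact subsets.\<close>

lemma radial_maximal_estimate:
  fixes f :: "complex \<Rightarrow> complex"
  assumes f: "f holomorphic_on ball 0 1" and l: "l > 0"
    and M: "\<And>\<rho>. 0 < \<rho> \<Longrightarrow> \<rho> < 1 \<Longrightarrow> integral {-pi..3*pi} (\<lambda>t. (cmod (f (of_real \<rho> * cis t)))\<^sup>2) \<le> M"
  defines "S \<equiv> {x\<in>{0..2*pi}. \<exists>s\<in>{0..<1}. (cmod (f (of_real s * cis x)))\<^sup>2 > l}"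
  shows "S \<in> lmeasurable" "measure lebesgue S \<le> 5 / l * M"
proof -
  have contf: "continuous_on (ball 0 1) f"
    using f holomorphic_on_imp_continuous_on by blast
  have contc: "continuous_on A (\<lambda>x. f (of_real s * cis x))" if "s \<in> {0..<1}" for s A
    by (rule continuous_on_compose2[OF contf]) (use that in \<open>auto intro!: continuous_intros simp: norm_mult\<close>)
  have "open (\<Union>s\<in>{0..<1}. {x. (cmod (f (of_real s * cis x)))\<^sup>2 > l})"
    by (intro open_UN ballI open_Collect_less continuous_intros contc)
  moreover have "S = {0..2*pi} \<inter> (\<Union>s\<in>{0..<1}. {x. (cmod (f (of_real s * cis x)))\<^sup>2 > l})"
    by (auto simp: S_def)
  ultimately have meas: "S \<in> sets lebesgue" by auto
  moreover have "S \<subseteq> cbox 0 (2*pi)" by (auto simp: S_def)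
  ultimately show lm: "S \<in> lmeasurable" using fmeasurableI2[OF lmeasurable_cbox] by blast
  show "measure lebesgue S \<le> 5 / l * M"
  proof (rule field_le_epsilon)
    fix e :: real assume e: "e > 0"
    obtain T where T: "closed T" "T \<subseteq> S" "S - T \<in> lmeasurable" "emeasure lebesgue (S - T) < ennreal e"
      using sets_lebesgue_inner_closed[OF meas e] by blast
    have "compact T"
      using T(1,2) \<open>S \<subseteq> cbox 0 (2*pi)\<close> by (meson bounded_cbox bounded_subset compact_eq_bounded_closed subset_trans)
    then have "measure lebesgue T \<le> 5 / l * M"
      using T(2) by (intro radial_maximal_compact[OF f l M]) (auto simp: S_def)
    moreover have "measure lebesgue S \<le> measure lebesgue T + measure lebesgue (S - T)"
      using measure_Un_le[of T lebesgue "S - T"] T \<open>compact T\<close> 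
      by (simp add: Un_absorb1 fmeasurableD lmeasurable_compact)
    moreover have "measure lebesgue (S - T) \<le> e"
      using T(3,4) e by (simp add: emeasure_eq_measure2 ennreal_less_iff)
    ultimately show "measure lebesgue S \<le> 5 / l * M + e" by linarith
  qed
qed

section \<open>Blaschke sequences\<close>

lemma one_minus_cnj_mult_ge:
  assumes "cmod a \<le> 1" "cmod z \<le> 1"
  shows "cmod (a - z) \<le> cmod (1 - cnj a * z)"
proof -
  have "(cmod (1 - cnj a * z))\<^sup>2 - (cmod (a - z))\<^sup>2 = (1 - (cmod a)\<^sup>2) * (1 - (cmod z)\<^sup>2)"
    unfolding cmod_power2 by (simp add: power2_eq_square algebra_simps)
  also have "\<dots> \<ge> 0"
    using assms by (intro mult_nonneg_nonneg) (auto simp: power_le_one)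
  finally have "(cmod (a - z))\<^sup>2 \<le> (cmod (1 - cnj a * z))\<^sup>2" by simp
  then show ?thesis by (rule power2_le_imp_le) simp
qed

lemma one_minus_cnj_mult_eq:
  assumes "cmod z = 1"
  shows "cmod (1 - cnj a * z) = cmod (a - z)"
proof -
  have "(cmod (1 - cnj a * z))\<^sup>2 - (cmod (a - z))\<^sup>2 = (1 - (cmod a)\<^sup>2) * (1 - (cmod z)\<^sup>2)"
    unfolding cmod_power2 by (simp add: power2_eq_square algebra_simps)
  then show ?thesis using assms by (simp add: power2_eq_iff_nonneg)
qed

lemma one_minus_cnj_mult_ge':
  assumes "cmod a \<le> 1" 
  shows "1 - cmod z \<le> cmod (1 - cnj a * z)"
proof -
  have "cmod (cnj a * z) \<le> cmod z"
    using assms by (simp add: norm_mult mult_left_le_one_le)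
  moreover have "1 - cmod (cnj a * z) \<le> cmod (1 - cnj a * z)"
    using norm_triangle_ineq2[of 1 "cnj a * z"] by simp
  ultimately show ?thesis by linarith
qed

lemma one_minus_cnj_mult_nonzero:
  assumes "cmod a < 1" "cmod z \<le> 1"
  shows "1 - cnj a * z \<noteq> 0"
proof
  assume "1 - cnj a * z = 0"
  then have "cmod a * cmod z = 1"
    by (metis complex_mod_cnj eq_iff_diff_eq_0 norm_mult norm_one)
  moreover have "cmod a * cmod z \<le> cmod a"
    using assms by (simp add: mult_left_le)
  ultimately show False using assms by simp
qed

lemma norm_blaschke_factor:
  assumes "a \<noteq> 0"
  shows "cmod (blaschke_factor a z) = cmod (a - z) / cmod (1 - cnj a * z)"
  using assms by (simp add: blaschke_factor_def norm_mult norm_divide)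

lemma norm_blaschke_factor_le_1:
  assumes "a \<in> ball 0 1 - {0}" "cmod z \<le> 1"
  shows "cmod (blaschke_factor a z) \<le> 1"
  using assms one_minus_cnj_mult_ge[of a z]
  by (auto simp: norm_blaschke_factor divide_le_eq_1)

lemma norm_blaschke_factor_eq_1:
  assumes "a \<in> ball 0 1 - {0}" "cmod z = 1"
  shows "cmod (blaschke_factor a z) = 1"
  using assms one_minus_cnj_mult_eq[of z a]
  by (auto simp: norm_blaschke_factor)

lemma blaschke_factor_0: "a \<noteq> 0 \<Longrightarrow> blaschke_factor a 0 = of_real (cmod a)"
  by (simp add: blaschke_factor_def)

lemma blaschke_factor_self [simp]: "blaschke_factor a a = 0"
  by (simp add: blaschke_factor_def)

lemma blaschke_factor_holomorphic:
  assumes "cmod a < 1"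
  shows "blaschke_factor a holomorphic_on cball 0 1"
  unfolding blaschke_factor_def
  using one_minus_cnj_mult_nonzero[OF assms] by (intro holomorphic_intros) auto

text \<open>The difference equals -(1 - |a|) (a + |a| z) / (a (1 - conj(a) z)), and |a + |a| z| is
  at most 2 |a|. The bound \<open>d\<close> is left free: it becomes \<open>1 - cmod z\<close>
  inside the disk, and half the distance to the zeros near a regular boundary point.\<close>

lemma blaschke_factor_minus_1:
  assumes a: "a \<in> ball 0 1 - {0}" and z: "cmod z \<le> 1" and d: "0 < d" "d \<le> cmod (1 - cnj a * z)"
  shows "cmod (blaschke_factor a z - 1) \<le> 2 / d * (1 - cmod a)"
proof -
  have nz: "a \<noteq> 0" "cmod a < 1" "1 - cnj a * z \<noteq> 0" using a d by auto
  have sq: "a * cnj a = of_real (cmod a) * of_real (cmod a)"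
    using complex_norm_square[of a] by (simp add: power2_eq_square)
  have "blaschke_factor a z - 1 = (of_real (cmod a) * (a - z) - a * (1 - cnj a * z)) / (a * (1 - cnj a * z))"
    using nz by (simp add: blaschke_factor_def field_simps)
  also have "of_real (cmod a) * (a - z) - a * (1 - cnj a * z) =
      - of_real (1 - cmod a) * (a + of_real (cmod a) * z)"
    using sq by (simp add: algebra_simps)
  finally have "cmod (blaschke_factor a z - 1) =
      (1 - cmod a) * cmod (a + of_real (cmod a) * z) / (cmod a * cmod (1 - cnj a * z))"
    using nz by (simp only: norm_mult norm_minus_cancel norm_of_real norm_divide)
  also have "\<dots> \<le> (1 - cmod a) * (2 * cmod a) / (cmod a * d)"
  proof (intro frac_le mult_left_mono mult_nonneg_nonneg)
    have "cmod (a + of_real (cmod a) * z) \<le> cmod a + cmod a * cmod z"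
      using norm_triangle_ineq[of a "of_real (cmod a) * z"] by (simp add: norm_mult)
    also have "\<dots> \<le> cmod a + cmod a * 1" using z by (intro add_left_mono mult_left_mono) auto
    finally show "cmod (a + of_real (cmod a) * z) \<le> 2 * cmod a" by simp
  qed (use nz d in auto)
  also have "\<dots> = 2 / d * (1 - cmod a)" using nz by simp
  finally show ?thesis .
qed

section \<open>Partial products and tails\<close>

locale blaschke_sequence =
  fixes a :: "nat \<Rightarrow> complex" and N :: enat
  assumes zeros: "enat n < N \<Longrightarrow> a n \<in> ball 0 1 - {0}"
    and summable: "summable (\<lambda>n. if enat n < N then 1 - cmod (a n) else 0)"
begin

definition gap :: "nat \<Rightarrow> real" where
  "gap n = (if enat n < N then 1 - cmod (a n) else 0)"

definition fac :: "nat \<Rightarrow> complex \<Rightarrow> complex" where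
  "fac n z = (if enat n < N then blaschke_factor (a n) z else 1)"

text \<open>\<open>tail 0\<close> is the whole product, apart from the unimodular constant and the
  power of z.\<close>

definition tail :: "nat \<Rightarrow> complex \<Rightarrow> complex" where
  "tail m z = (\<Prod>n. fac (n + m) z)"

lemma gap_nonneg: "gap n \<ge> 0"
  using zeros[of n] by (auto simp: gap_def)

lemma summable_gap: "summable gap"
  using summable by (simp add: gap_def[abs_def])

lemma summable_gap_offset: "summable (\<lambda>n. gap (n + m))"
  using summable_gap by (simp add: summable_iff_shift)

lemma norm_fac_le_1: "cmod z \<le> 1 \<Longrightarrow> cmod (fac n z) \<le> 1"
  using norm_blaschke_factor_le_1[OF zeros] by (simp add: fac_def)

lemma norm_fac_eq_1: "cmod z = 1 \<Longrightarrow> cmod (fac n z) = 1"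
  using norm_blaschke_factor_eq_1[OF zeros] by (simp add: fac_def)

lemma fac_holomorphic: "fac n holomorphic_on cball 0 1"
  using blaschke_factor_holomorphic[of "a n"] zeros[of n]
  by (cases "enat n < N") (auto simp: fac_def[abs_def])

lemma norm_fac_minus_1:
  assumes "cmod z < 1"
  shows "cmod (fac n z - 1) \<le> 2 / (1 - cmod z) * gap n"
  using blaschke_factor_minus_1[OF zeros, of n z "1 - cmod z"] one_minus_cnj_mult_ge'[of "a n" z] zeros[of n] assms
  by (auto simp: fac_def gap_def)

lemma convergent_prod_fac: "cmod z < 1 \<Longrightarrow> convergent_prod (\<lambda>n. fac n z)"
  unfolding fac_def using blaschke_convergent_prod[OF zeros summable] by simp

lemma convergent_prod_fac_offset:
  assumes "cmod z < 1"
  shows "convergent_prod (\<lambda>n. fac (n + m) z)"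
  by (rule convergent_prod_ignore_initial_segment[OF convergent_prod_fac[OF assms]])

lemma tail_LIMSEQ: "cmod z < 1 \<Longrightarrow> (\<lambda>M. \<Prod>n<M. fac (n + m) z) \<longlonglongrightarrow> tail m z"
  unfolding tail_def
  by (intro has_prod_imp_tendsto' convergent_prod_has_prod convergent_prod_fac_offset)

lemma norm_prod_fac_le_1: "cmod z \<le> 1 \<Longrightarrow> cmod (\<Prod>n\<in>A. fac (f n) z) \<le> 1"
  unfolding prod_norm[symmetric] by (intro prod_le_1) (auto simp: norm_fac_le_1)

lemma norm_tail_le_1:
  assumes "cmod z < 1"
  shows "cmod (tail m z) \<le> 1"
  by (rule LIMSEQ_le_const2[OF tendsto_norm[OF tail_LIMSEQ[OF assms, of m]]])
    (use norm_prod_fac_le_1[of z] assms in \<open>auto intro!: exI[of _ 0]\<close>)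

text \<open>Comparing limits of partial products also covers points where some factors
  vanish.\<close>

lemma tail_split:
  assumes "cmod z < 1"
  shows "tail 0 z = (\<Prod>n<m. fac n z) * tail m z"
proof (rule LIMSEQ_unique)
  have e: "(\<Prod>n<M+m. fac n z) = (\<Prod>n<m. fac n z) * (\<Prod>n<M. fac (n + m) z)" for M
  proof (induction M)
    case (Suc M)
    then show ?case by (simp add: mult.assoc)
  qed simp
  show "(\<lambda>M. \<Prod>n<M+m. fac n z) \<longlonglongrightarrow> tail 0 z"
    using tail_LIMSEQ[OF assms, of 0] by (intro LIMSEQ_ignore_initial_segment) simp
  show "(\<lambda>M. \<Prod>n<M+m. fac n z) \<longlonglongrightarrow> (\<Prod>n<m. fac n z) * tail m z"
    unfolding e by (intro tendsto_intros tail_LIMSEQ assms)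
qed

text \<open>A Weierstrass M-test on sets that may touch the unit circle: it gives holomorphy of the
  tails inside and continuity up to the boundary away from the zeros.\<close>

lemma uniformly_convergent_prod_fac:
  assumes X: "compact X" "X \<subseteq> cball 0 1" and C: "\<And>n z. z \<in> X \<Longrightarrow> cmod (fac n z - 1) \<le> C * gap n"
  shows "uniformly_convergent_on X (\<lambda>M z. \<Prod>n<M. fac (n + m) z)"
proof (rule uniformly_convergent_on_prod')
  show "continuous_on X (fac (n + m))" for n
    using holomorphic_on_imp_continuous_on[OF fac_holomorphic] X(2) continuous_on_subset by blast
  show "uniformly_convergent_on X (\<lambda>M z. \<Sum>n<M. norm (fac (n + m) z - 1))"
    by (rule Weierstrass_m_test'[OF _ summable_mult[OF summable_gap_offset[of m], of C]])
      (use C in auto)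
qed (rule X)

lemma tail_holomorphic: "tail m holomorphic_on ball 0 1"
proof (rule holomorphic_uniform_sequence)
  show "(\<lambda>z. \<Prod>n<M. fac (n + m) z) holomorphic_on ball 0 1" for M
    by (intro holomorphic_intros holomorphic_on_subset[OF fac_holomorphic]) auto
  fix z :: complex assume z: "z \<in> ball 0 1"
  define d where "d = (1 - cmod z) / 2"
  have d: "d > 0" "cmod w \<le> 1 - d" if "w \<in> cball z d" for w
  proof -
    show "d > 0" using z by (simp add: d_def)
    have "cmod w \<le> cmod z + d" using that norm_triangle_sub[of w z] by (simp add: dist_norm norm_minus_commute)
    then show "cmod w \<le> 1 - d" by (simp add: d_def field_simps)
  qed
  have sub: "cball z d \<subseteq> ball 0 1" using d by fastforce
  have "d > 0" using z by (simp add: d_def)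
  have "uniformly_convergent_on (cball z d) (\<lambda>M z. \<Prod>n<M. fac (n + m) z)"
  proof (rule uniformly_convergent_prod_fac)
    fix n w assume w: "w \<in> cball z d"
    have "cmod (fac n w - 1) \<le> 2 / (1 - cmod w) * gap n"
      using w sub by (intro norm_fac_minus_1) auto
    also have "\<dots> \<le> 2 / d * gap n"
      using d[OF w] gap_nonneg by (intro mult_right_mono divide_left_mono) auto
    finally show "cmod (fac n w - 1) \<le> 2 / d * gap n" .
  qed (use sub in \<open>auto simp: subset_iff\<close>)
  then obtain l where l: "uniform_limit (cball z d) (\<lambda>M z. \<Prod>n<M. fac (n + m) z) l sequentially"
    by (auto simp: uniformly_convergent_on_def)
  have "l w = tail m w" if "w \<in> cball z d" for w
    using LIMSEQ_unique[OF tendsto_uniform_limitI[OF l that] tail_LIMSEQ] sub that by auto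
  then have "uniform_limit (cball z d) (\<lambda>M z. \<Prod>n<M. fac (n + m) z) (tail m) sequentially"
    by (subst uniform_limit_cong'[where g = "\<lambda>M z. \<Prod>n<M. fac (n + m) z" and i = l]) (use l in auto)
  then show "\<exists>d>0. cball z d \<subseteq> ball 0 1 \<and> uniform_limit (cball z d) (\<lambda>M z. \<Prod>n<M. fac (n + m) z) (tail m) sequentially"
    using \<open>d > 0\<close> sub by blast
qed auto

section \<open>Radial limits of modulus 1 almost everywhere\<close>

lemma tail_0_LIMSEQ: "(\<lambda>m. tail m 0) \<longlonglongrightarrow> 1"
proof -
  \<comment> \<open>At the origin each factor is |a_n| or the padding 1, so the whole product is
    nonzero there, and dividing it by its partial products leaves tails that tend to 1.\<close>
  have nz: "fac n 0 \<noteq> 0" for n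
    using zeros[of n] by (simp add: fac_def blaschke_factor_0)
  then have "tail 0 0 \<noteq> 0"
    using prodinf_nonzero[of "\<lambda>n. fac n 0"] convergent_prod_fac[of 0] by (simp add: tail_def)
  moreover have "(\<lambda>m. \<Prod>n<m. fac n 0) \<longlonglongrightarrow> tail 0 0"
    using tail_LIMSEQ[of 0 0] by simp
  ultimately have "(\<lambda>m. tail 0 0 / (\<Prod>n<m. fac n 0)) \<longlonglongrightarrow> tail 0 0 / tail 0 0"
    by (intro tendsto_intros)
  moreover have "tail 0 0 / (\<Prod>n<m. fac n 0) = tail m 0" for m
    using tail_split[of 0 m] nz by simp
  ultimately show ?thesis using \<open>tail 0 0 \<noteq> 0\<close> by simp
qed

text \<open>Since |G| \<le> 1, |1 - G|^2 \<le> 2 - 2 Re G, and the mean value property evaluates the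
  integral of Re G. The interval consists of two full periods, which gives the factor 8 pi.\<close>

lemma tail_square_mean:
  assumes \<rho>: "0 < \<rho>" "\<rho> < 1"
  shows "integral {-pi..3*pi} (\<lambda>t. (cmod (1 - tail m (of_real \<rho> * cis t)))\<^sup>2) \<le> 8 * pi * (1 - Re (tail m 0))"
proof -
  define G where "G t = tail m (of_real \<rho> * cis t)" for t
  have sub: "of_real \<rho> * z \<in> ball 0 1" if "z \<in> cball 0 1" for z :: complex
  proof -
    have "\<rho> * cmod z \<le> \<rho>" using \<rho> that by (simp add: mult_left_le)
    then have "\<rho> * cmod z < 1" using \<rho>(2) by linarith
    then show ?thesis using \<rho>(1) by (simp add: norm_mult)
  qed
  have contG: "continuous_on A G" for A
    unfolding G_def
    by (rule continuous_on_compose2[OF holomorphic_on_imp_continuous_on[OF tail_holomorphic]])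
      (use sub in \<open>auto intro!: continuous_intros\<close>)
  have h: "(\<lambda>z. tail m (of_real \<rho> * z)) holomorphic_on cball 0 1"
    by (rule holomorphic_on_compose_gen[OF _ tail_holomorphic, unfolded comp_def])
      (use sub in \<open>auto intro!: holomorphic_intros\<close>)
  \<comment> \<open>For \<open>r = 0\<close> the Poisson kernel is constantly 1, so Poisson's
    formula is the mean value property.\<close>
  have 1: "(G has_integral 2 * of_real pi * tail m 0) {-pi..pi}"
    using poisson_integral[OF h, of 0] by (simp add: poisson_kernel_def G_def[abs_def])
  have per: "G (t + - (2 * pi)) = G t" for t
    by (simp add: G_def cis.ctr cos_diff sin_diff)
  have "(G has_integral 2 * of_real pi * tail m 0) {pi..3*pi}"
    using has_integral_shift_real_ivl[OF 1, of "-(2 * pi)"] unfolding per by simp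
  with 1 have "(G has_integral (2 * of_real pi * tail m 0 + 2 * of_real pi * tail m 0)) {-pi..3*pi}"
    by (rule has_integral_combine[rotated 2]) auto
  from has_integral_linear[OF this bounded_linear_Re]
  have ReG: "((\<lambda>t. Re (G t)) has_integral 4 * pi * Re (tail m 0)) {-pi..3*pi}"
    by (simp add: comp_def mult.assoc)
  have R: "((\<lambda>t. 2 - 2 * Re (G t)) has_integral 8 * pi - 2 * (4 * pi * Re (tail m 0))) {-pi..3*pi}"
    using has_integral_const_real[of "2::real" "-pi" "3*pi"]
    by (intro has_integral_diff has_integral_mult_right ReG) simp
  have "integral {-pi..3*pi} (\<lambda>t. (cmod (1 - G t))\<^sup>2) \<le> integral {-pi..3*pi} (\<lambda>t. 2 - 2 * Re (G t))"
  proof (rule integral_le)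
    show "(\<lambda>t. (cmod (1 - G t))\<^sup>2) integrable_on {-pi..3*pi}"
      by (intro integrable_continuous_real continuous_intros contG)
    fix t
    have "cmod (G t) \<le> 1" unfolding G_def using sub[of "cis t"] by (intro norm_tail_le_1) auto
    then have "(Re (G t))\<^sup>2 + (Im (G t))\<^sup>2 \<le> 1" 
      by (simp add: cmod_power2[symmetric] power_le_one)
    then show "(cmod (1 - G t))\<^sup>2 \<le> 2 - 2 * Re (G t)"
      unfolding cmod_power2 by (simp add: power2_eq_square algebra_simps)
  qed (use R in auto)
  also have "\<dots> = 8 * pi * (1 - Re (tail m 0))"
    unfolding integral_unique[OF R] by (simp add: algebra_simps)
  finally show ?thesis unfolding G_def .
qed

text \<open>Off sets of small total measure, suitable tails are within \<open>(1/2) ^ j\<close> of 1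
  along the whole radius. There the product is uniformly close to finite products, which are
  continuous up to the circle and have modulus 1 on it.\<close>

lemma radial_limit_negligible:
  "negligible {x\<in>{0..2*pi}. \<not> (\<exists>L. cmod L = 1 \<and> ((\<lambda>r. tail 0 (of_real r * cis x)) \<longlongrightarrow> L) (at_left 1))}"
    (is "negligible ?Z")
  unfolding negligible_outer_le
proof (intro allI impI)
  fix e :: real assume e: "e > 0"
  \<comment> \<open>The maximal estimate concerns squared moduli, so the threshold is the square of
    the intended bound \<open>(1/2) ^ j\<close>.\<close>
  define l :: "nat \<Rightarrow> real" where "l j = ((1/2) ^ j)\<^sup>2" for j
  have l: "l j > 0" for j by (simp add: l_def)
  have "\<exists>m. 5 / l j * (8 * pi * (1 - Re (tail m 0))) \<le> e * (1/2) ^ Suc j" for j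
  proof -
    have "(\<lambda>m. 5 / l j * (8 * pi * (1 - Re (tail m 0)))) \<longlonglongrightarrow> 5 / l j * (8 * pi * (1 - Re 1))"
      by (intro tendsto_intros tail_0_LIMSEQ)
    then have "eventually (\<lambda>m. 5 / l j * (8 * pi * (1 - Re (tail m 0))) < e * (1/2) ^ Suc j) sequentially"
      using e by (rule_tac order_tendstoD(2)) auto
    from eventually_happens[OF this] show ?thesis by (auto intro: less_imp_le)
  qed
  then obtain m where m: "5 / l j * (8 * pi * (1 - Re (tail (m j) 0))) \<le> e * (1/2) ^ Suc j" for j
    by metis
  define S where "S j = {x\<in>{0..2*pi}. \<exists>s\<in>{0..<1}. (cmod (1 - tail (m j) (of_real s * cis x)))\<^sup>2 > l j}" for j
  have hol: "(\<lambda>z. 1 - tail (m j) z) holomorphic_on ball 0 1" for j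
    by (intro holomorphic_intros tail_holomorphic)
  have S_bound: "measure lebesgue (S j) \<le> 5 / l j * (8 * pi * (1 - Re (tail (m j) 0)))" for j
    unfolding S_def by (rule radial_maximal_estimate(2)[OF hol l tail_square_mean])
  have S: "S j \<in> lmeasurable" "measure lebesgue (S j) \<le> e * (1/2) ^ Suc j" for j
    unfolding S_def by (rule radial_maximal_estimate(1)[OF hol l tail_square_mean], assumption+)
      (fact order_trans[OF S_bound m, unfolded S_def])
  have "?Z \<subseteq> (\<Union>j. S j)"
  proof (rule ccontr)
    assume "\<not> ?thesis"
    then obtain x where x: "x \<in> ?Z" "\<And>j. x \<notin> S j" by blast
    have close: "cmod (1 - tail (m j) (of_real s * cis x)) \<le> (1/2) ^ j" if "s \<in> {0..<1}" for s j
    proof (rule power2_le_imp_le)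
      have "\<not> (cmod (1 - tail (m j) (of_real s * cis x)))\<^sup>2 > l j"
        using x(2)[of j] x(1) that unfolding S_def by blast
      then show "(cmod (1 - tail (m j) (of_real s * cis x)))\<^sup>2 \<le> ((1/2) ^ j)\<^sup>2" 
        unfolding l_def by linarith
    qed simp
    \<comment> \<open>Boundary values of the finite products; compactness of the circle yields a
      convergent subsequence, whose limit is the radial limit.\<close>
    define g where "g j = (\<Prod>n<m j. fac n (cis x))" for j
    have "cmod (g j) = 1" for j
      unfolding g_def prod_norm[symmetric] by (simp add: norm_fac_eq_1)
    then have "\<forall>j. g j \<in> sphere 0 1" by simp
    moreover have "seq_compact (sphere (0::complex) 1)"
      using compact_sphere by (simp add: compact_eq_seq_compact_metric)
    ultimately obtain L r where L: "L \<in> sphere 0 1" and r: "strict_mono r" "(g \<circ> r) \<longlonglongrightarrow> L"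
      unfolding seq_compact_def by blast
    have "((\<lambda>s. tail 0 (of_real s * cis x)) \<longlongrightarrow> L) (at_left 1)"
    proof (rule tendstoI)
      fix \<epsilon> :: real assume \<epsilon>: "\<epsilon> > 0"
      have "eventually (\<lambda>j. dist ((g \<circ> r) j) L < \<epsilon>/3) sequentially"
        using \<epsilon> by (intro tendstoD[OF r(2)]) auto
      moreover have "eventually (\<lambda>j. (1/2::real) ^ j < \<epsilon>/3) sequentially"
        using \<epsilon> by (intro order_tendstoD(2)[OF LIMSEQ_realpow_zero]) auto
      ultimately have "eventually (\<lambda>j. dist ((g \<circ> r) j) L < \<epsilon>/3 \<and> (1/2::real) ^ j < \<epsilon>/3) sequentially"
        by eventually_elim auto
      then obtain j where j: "dist (g (r j)) L < \<epsilon>/3" "(1/2::real) ^ j < \<epsilon>/3"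
        by (auto simp: eventually_sequentially)
      \<comment> \<open>Since \<open>r j \<ge> j\<close>, the single index \<open>k\<close> serves
        both for the boundary value being near \<open>L\<close> and for the tail being near
        1.\<close>
      define k where "k = r j"
      have "(1/2::real) ^ k \<le> (1/2) ^ j"
        unfolding k_def using seq_suble[OF r(1), of j] by (intro power_decreasing) auto
      then have k: "dist (g k) L < \<epsilon>/3" "(1/2::real) ^ k < \<epsilon>/3"
        using j unfolding k_def by linarith+
      have "((\<lambda>s. \<Prod>n<m k. fac n (of_real s * cis x)) \<longlongrightarrow> g k) (at 1 within {0..1})"
      proof -
        have c: "continuous_on {0..1} (\<lambda>s. fac n (of_real s * cis x))" for n
          by (rule continuous_on_compose2[OF holomorphic_on_imp_continuous_on[OF fac_holomorphic]])
            (auto intro!: continuous_intros simp: norm_mult)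
        have "continuous_on {0..1::real} (\<lambda>s. \<Prod>n<m k. fac n (of_real s * cis x))"
          by (intro continuous_intros c)
        from this[unfolded continuous_on_def, rule_format, of 1] show ?thesis
          by (simp add: g_def)
      qed
      then have "((\<lambda>s. \<Prod>n<m k. fac n (of_real s * cis x)) \<longlongrightarrow> g k) (at_left 1)"
        by (simp add: at_within_Icc_at_left)
      then have "eventually (\<lambda>s. dist (\<Prod>n<m k. fac n (of_real s * cis x)) (g k) < \<epsilon>/3) (at_left 1)"
        using \<epsilon> by (intro tendstoD) auto
      moreover have "eventually (\<lambda>s. s \<in> {0<..<1::real}) (at_left 1)"
        by (rule eventually_at_leftI[of 0]) auto
      ultimately show "eventually (\<lambda>s. dist (tail 0 (of_real s * cis x)) L < \<epsilon>) (at_left 1)"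
      proof eventually_elim
        case (elim s)
        define P where "P = (\<Prod>n<m k. fac n (of_real s * cis x))"
        have s: "cmod (of_real s * cis x) < 1" using elim by (simp add: norm_mult)
        have "tail 0 (of_real s * cis x) - P = - P * (1 - tail (m k) (of_real s * cis x))"
          unfolding tail_split[OF s, of "m k"] P_def by (simp add: algebra_simps)
        then have "dist (tail 0 (of_real s * cis x)) P = cmod P * cmod (1 - tail (m k) (of_real s * cis x))"
          by (simp add: dist_norm norm_mult)
        also have "\<dots> \<le> 1 * (1/2) ^ k"
          unfolding P_def using elim s by (intro mult_mono norm_prod_fac_le_1 close) auto
        finally have "dist (tail 0 (of_real s * cis x)) P < \<epsilon>/3" using k by simp
        then show ?case
          using elim(1) k(1) dist_triangle_third[of "tail 0 (of_real s * cis x)" P \<epsilon> "g k" L]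
          by (simp add: P_def)
      qed
    qed
    with x(1) L show False by simp
  qed
  moreover have "measure lebesgue (\<Union>j\<in>I. S j) \<le> e" if "finite I" for I
  proof -
    have "measure lebesgue (\<Union>j\<in>I. S j) \<le> (\<Sum>j\<in>I. measure lebesgue (S j))"
      using that S by (intro measure_UNION_le) (auto simp: fmeasurableD)
    also have "\<dots> \<le> (\<Sum>j\<in>I. e * (1/2) ^ Suc j)" by (intro sum_mono S)
    also have "\<dots> \<le> (\<Sum>j. e * (1/2) ^ Suc j)"
      using that e power_half_series by (intro sum_le_suminf summable_mult) (auto simp: sums_iff)
    also have "\<dots> = e"
      using sums_mult[OF power_half_series, of e] by (simp add: sums_iff)
    finally show ?thesis .
  qed
  then have "(\<Union>j. S j) \<in> lmeasurable" "measure lebesgue (\<Union>j. S j) \<le> e"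
    using fmeasurable_UN_bound[of UNIV S lebesgue e] measure_UN_bound[of UNIV S lebesgue e] S(1) by auto
  ultimately show "\<exists>T. ?Z \<subseteq> T \<and> T \<in> lmeasurable \<and> measure lebesgue T \<le> e" by blast
qed

text \<open>Within \<open>d / 2\<close> of \<zeta> every denominator |1 - conj(a_n) z| is at least
  \<open>d / 2\<close>, also on the circle. The product therefore converges uniformly on a closed
  neighbourhood of \<zeta> in the closed disk, and its limit is continuous there.\<close>

lemma unrestricted_limit_tail:
  assumes \<zeta>: "\<zeta> \<in> sphere 0 1" and d: "d > 0" and far: "\<And>n. enat n < N \<Longrightarrow> d \<le> dist (a n) \<zeta>"
  shows "has_unrestricted_limit (tail 0) \<zeta>"
proof -
  define X where "X = cball 0 1 \<inter> cball \<zeta> (d / 2)"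
  have "uniformly_convergent_on X (\<lambda>M z. \<Prod>n<M. fac (n + 0) z)"
  proof (rule uniformly_convergent_prod_fac)
    show "compact X" by (simp add: X_def compact_Int)
    show "X \<subseteq> cball 0 1" by (simp add: X_def)
    fix n z assume z: "z \<in> X"
    show "cmod (fac n z - 1) \<le> 2 / (d / 2) * gap n"
    proof (cases "enat n < N")
      case True
      have "d / 2 \<le> dist (a n) z"
        using far[OF True] z dist_triangle[of "a n" \<zeta> z] by (simp add: X_def dist_commute)
      also have "\<dots> \<le> cmod (1 - cnj (a n) * z)"
        unfolding dist_norm using zeros[OF True] z by (intro one_minus_cnj_mult_ge) (auto simp: X_def)
      finally show ?thesis
        using blaschke_factor_minus_1[OF zeros[OF True], of z "d / 2"] True z d
        by (simp add: fac_def gap_def X_def)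
    qed (simp add: fac_def gap_def)
  qed
  then obtain l where l: "uniform_limit X (\<lambda>M z. \<Prod>n<M. fac (n + 0) z) l sequentially"
    by (auto simp: uniformly_convergent_on_def)
  have "continuous_on X l"
  proof (rule uniform_limit_theorem[OF _ l])
    show "\<forall>\<^sub>F M in sequentially. continuous_on X (\<lambda>z. \<Prod>n<M. fac (n + 0) z)"
      by (intro always_eventually allI continuous_intros
          continuous_on_subset[OF holomorphic_on_imp_continuous_on[OF fac_holomorphic]]) (simp add: X_def)
  qed simp
  moreover have "\<zeta> \<in> X" using \<zeta> d by (simp add: X_def)
  ultimately have "(l \<longlongrightarrow> l \<zeta>) (at \<zeta> within X)" by (simp add: continuous_on_def)
  then have "(l \<longlongrightarrow> l \<zeta>) (at \<zeta> within X \<inter> ball 0 1)"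
    by (rule tendsto_within_subset) auto
  moreover have "eventually (\<lambda>z. l z = tail 0 z) (at \<zeta> within X \<inter> ball 0 1)"
    unfolding eventually_at_filter
  proof (intro always_eventually allI impI)
    fix z assume "z \<in> X \<inter> ball 0 1"
    then show "l z = tail 0 z"
      using LIMSEQ_unique[OF tendsto_uniform_limitI[OF l] tail_LIMSEQ] by auto
  qed
  ultimately have "(tail 0 \<longlongrightarrow> l \<zeta>) (at \<zeta> within X \<inter> ball 0 1)"
    by (rule Lim_transform_eventually)
  moreover have "at \<zeta> within X \<inter> ball 0 1 = at \<zeta> within ball 0 1"
    by (rule at_within_nhd[of _ "ball \<zeta> (d / 2)"]) (use d in \<open>auto simp: X_def\<close>)
  ultimately show ?thesis unfolding has_unrestricted_limit_def by auto
qed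

text \<open>Weierstrass's inequality: a product of 1 - x_n with x_n in [0, 1] is at least 1 minus
  the sum of the x_n, applied to x_n = 1 - |fac|.\<close>

lemma tail_lower_bound:
  assumes z: "cmod z < 1" and e: "\<And>M. (\<Sum>n\<in>{m..<M}. gap n) \<le> e"
  shows "1 - 2 / (1 - cmod z) * e \<le> cmod (tail m z)"
proof (rule LIMSEQ_le_const[OF tendsto_norm[OF tail_LIMSEQ[OF z]]])
  have "1 - 2 / (1 - cmod z) * e \<le> cmod (\<Prod>n<M. fac (n + m) z)" for M
  proof -
    have "(\<Sum>n<M. gap (n + m)) \<le> e"
      using e[of "M + m"] sum.shift_bounds_nat_ivl[of gap 0 m M] by (simp add: atLeast0LessThan)
    then have "2 / (1 - cmod z) * (\<Sum>n<M. gap (n + m)) \<le> 2 / (1 - cmod z) * e"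
      using z by (intro mult_left_mono) auto
    moreover have "(\<Sum>n<M. 1 - cmod (fac (n + m) z)) \<le> (\<Sum>n<M. 2 / (1 - cmod z) * gap (n + m))"
    proof (rule sum_mono)
      fix n
      have "1 - cmod (fac (n + m) z) \<le> cmod (fac (n + m) z - 1)"
        using norm_triangle_ineq2[of 1 "fac (n + m) z"] by (simp add: norm_minus_commute)
      with norm_fac_minus_1[OF z, of "n + m"]
      show "1 - cmod (fac (n + m) z) \<le> 2 / (1 - cmod z) * gap (n + m)" by linarith
    qed
    moreover have "1 - (\<Sum>n<M. 1 - cmod (fac (n + m) z)) \<le> (\<Prod>n<M. 1 - (1 - cmod (fac (n + m) z)))"
      using z norm_fac_le_1 by (intro Weierstrass_prod_ineq) auto
    ultimately show ?thesis
      by (simp add: sum_distrib_left prod_norm)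
  qed
  then show "\<exists>K. \<forall>M\<ge>K. 1 - 2 / (1 - cmod z) * e \<le> cmod (\<Prod>n<M. fac (n + m) z)" by blast
qed

lemma norm_tail_0_le_fac:
  assumes "cmod z < 1"
  shows "cmod (tail 0 z) \<le> cmod (fac n z)"
proof -
  have *: "tail 0 z = (\<Prod>i<n. fac i z) * (fac n z * tail (Suc n) z)"
    using tail_split[OF assms, of "Suc n"] by (simp add: mult.assoc)
  have "cmod (\<Prod>i<n. fac i z) \<le> 1" "cmod (tail (Suc n) z) \<le> 1"
    using assms norm_prod_fac_le_1[of z "\<lambda>i. i" "{..<n}"] by (auto intro: norm_tail_le_1)
  then have "cmod (tail 0 z) \<le> 1 * (cmod (fac n z) * 1)"
    unfolding * norm_mult by (intro mult_mono mult_left_mono) auto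
  then show ?thesis by simp
qed

lemma tail_0_zero: "enat n < N \<Longrightarrow> tail 0 (a n) = 0"
  using norm_tail_0_le_fac[of "a n" n] zeros[of n] by (auto simp: fac_def)

end

section \<open>Null sets on the circle and the necessity of (b)\<close>

lemma unimodular_eq_cis:
  assumes "cmod z = 1"
  obtains t where "0 \<le> t" "t < 2 * pi" "z = cis t"
  using complex_unimodular_polar[OF assms] by (metis cis.code)

lemma unrestricted_imp_radial_limit:
  assumes "has_unrestricted_limit f \<zeta>" "\<zeta> \<in> sphere 0 1"
  shows "has_radial_limit f \<zeta>"
proof -
  obtain L where L: "(f \<longlongrightarrow> L) (at \<zeta> within ball 0 1)"
    using assms by (auto simp: has_unrestricted_limit_def)
  have "filterlim (\<lambda>r. of_real r * \<zeta>) (at \<zeta> within ball 0 1) (at_left (1::real))"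
    unfolding filterlim_at
  proof
    have "eventually (\<lambda>r::real. r \<in> {0<..<1}) (at_left 1)"
      by (rule eventually_at_leftI[of 0]) auto
    then show "eventually (\<lambda>r::real. of_real r * \<zeta> \<in> ball 0 1 \<and> of_real r * \<zeta> \<noteq> \<zeta>) (at_left 1)"
      by eventually_elim (use assms(2) in \<open>auto simp: norm_mult\<close>)
    have "((\<lambda>r::real. of_real r * \<zeta>) \<longlongrightarrow> of_real 1 * \<zeta>) (at_left 1)"
      by (intro tendsto_intros)
    then show "((\<lambda>r::real. of_real r * \<zeta>) \<longlongrightarrow> \<zeta>) (at_left 1)" by simp
  qed
  from filterlim_compose[OF L this] show ?thesis
    by (auto simp: has_radial_limit_def)
qed

text \<open>Closedness makes the set and its preimage Borel, so the completion does not interfere.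
  The closed parameter interval adds at most the point 2 pi and makes the set of angles compact for
  the later covering argument.\<close>

lemma emeasure_circle_lebesgue_eq_0_iff:
  assumes E: "closed E" "E \<subseteq> sphere 0 1"
  shows "emeasure circle_lebesgue E = 0 \<longleftrightarrow> negligible {x\<in>{0..2*pi}. cis x \<in> E}"
proof -
  let ?S = "{x\<in>{0..<2*pi}. cis x \<in> E}"
  let ?M = "distr (restrict_space lborel {0..<2 * pi}) (restrict_space borel (sphere 0 1)) cis"
  have EM: "E \<in> sets (restrict_space borel (sphere 0 1))"
    using E by (auto simp: sets_restrict_space image_iff intro!: bexI[of _ E])
  have "emeasure circle_lebesgue E = emeasure ?M E"
    unfolding circle_lebesgue_def using EM by simp
  also have "\<dots> = emeasure (restrict_space lborel {0..<2 * pi}) ?S"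
    by (subst emeasure_distr[OF cis_measurable_circle EM])
      (auto simp: space_restrict_space intro!: arg_cong2[where f = emeasure])
  also have "\<dots> = emeasure lborel ?S"
    by (intro emeasure_restrict_space) auto
  finally have 1: "emeasure circle_lebesgue E = emeasure lborel ?S" .
  have "closed (cis -` E)"
    using E by (intro closed_vimage) (auto intro!: continuous_intros)
  then have "{0..<2*pi} \<inter> cis -` E \<in> sets lborel" by simp
  moreover have "{0..<2*pi} \<inter> cis -` E = ?S" by auto
  ultimately have "?S \<in> sets lborel" by simp
  then have "emeasure lborel ?S = 0 \<longleftrightarrow> negligible ?S"
    unfolding negligible_iff_null_sets by (simp add: null_sets_completion_iff null_sets_def)
  also have "\<dots> \<longleftrightarrow> negligible {x\<in>{0..2*pi}. cis x \<in> E}"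
  proof
    assume "negligible ?S"
    then have "negligible (insert (2*pi) ?S)" by simp
    then show "negligible {x\<in>{0..2*pi}. cis x \<in> E}"
      by (rule negligible_subset) auto
  qed (auto elim!: negligible_subset)
  finally show ?thesis using 1 by simp
qed

lemma blaschke_product_necessary:
  assumes E: "E \<subseteq> sphere 0 1" and B: "blaschke_product B"
    and rad: "\<And>\<zeta>. \<zeta> \<in> E \<Longrightarrow> \<not> has_radial_limit B \<zeta>"
    and unr: "\<And>\<zeta>. \<zeta> \<in> sphere 0 1 - E \<Longrightarrow> has_unrestricted_limit B \<zeta>"
  shows "closedin (top_of_set (sphere 0 1)) E" "emeasure circle_lebesgue E = 0"
proof -
  obtain c k N a where c: "cmod c = 1"
    and a: "\<And>n. enat n < N \<Longrightarrow> a n \<in> ball 0 1 - {0}"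
    and sm: "summable (\<lambda>n. if enat n < N then 1 - cmod (a n) else 0)"
    and Beq: "\<And>z. z \<in> ball 0 1 \<Longrightarrow> B z = c * z ^ k * (\<Prod>n. if enat n < N then blaschke_factor (a n) z else 1)"
    using B unfolding blaschke_product_def by blast
  interpret blaschke_sequence a N by unfold_locales (use a sm in auto)
  have B_tail: "B z = c * z ^ k * tail 0 z" if "z \<in> ball 0 1" for z
    using Beq[OF that] by (simp add: tail_def fac_def)
  define Z where "Z = {x\<in>{0..2*pi}. \<not> (\<exists>L. cmod L = 1 \<and> ((\<lambda>r. B (of_real r * cis x)) \<longlongrightarrow> L) (at_left 1))}"
  have Z: "negligible Z"
  proof (rule negligible_subset[OF radial_limit_negligible])
    have "\<exists>L. cmod L = 1 \<and> ((\<lambda>r. B (of_real r * cis x)) \<longlongrightarrow> L) (at_left 1)"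
      if L: "cmod L = 1" "((\<lambda>r. tail 0 (of_real r * cis x)) \<longlongrightarrow> L) (at_left 1)" for x L
    proof (intro exI conjI)
      have "((\<lambda>r. c * (of_real r * cis x) ^ k * tail 0 (of_real r * cis x)) \<longlongrightarrow> c * (of_real 1 * cis x) ^ k * L) (at_left 1)"
        by (intro tendsto_intros L)
      moreover have "eventually (\<lambda>r. c * (of_real r * cis x) ^ k * tail 0 (of_real r * cis x) = B (of_real r * cis x)) (at_left 1)"
        by (rule eventually_at_leftI[of 0]) (auto simp: B_tail norm_mult)
      ultimately show "((\<lambda>r. B (of_real r * cis x)) \<longlongrightarrow> c * (of_real 1 * cis x) ^ k * L) (at_left 1)"
        by (rule Lim_transform_eventually)
      show "cmod (c * (of_real 1 * cis x) ^ k * L) = 1"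
        using c L by (simp add: norm_mult norm_power)
    qed
    then show "Z \<subseteq> {x\<in>{0..2*pi}. \<not> (\<exists>L. cmod L = 1 \<and> ((\<lambda>r. tail 0 (of_real r * cis x)) \<longlongrightarrow> L) (at_left 1))}"
      unfolding Z_def by blast
  qed
  have open_compl: "\<exists>d>0. ball \<zeta>0 d \<inter> sphere 0 1 \<subseteq> - E" if \<zeta>0: "\<zeta>0 \<in> sphere 0 1 - E" for \<zeta>0
  proof -
    obtain L0 where L0: "(B \<longlongrightarrow> L0) (at \<zeta>0 within ball 0 1)"
      using unr[OF \<zeta>0] by (auto simp: has_unrestricted_limit_def)
    have near: "\<exists>d>0. \<forall>z\<in>ball 0 1 \<inter> ball \<zeta>0 d. cmod (B z - L0) < e" if "e > 0" for e
    proof -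
      have "eventually (\<lambda>z. dist (B z) L0 < e) (at \<zeta>0 within ball 0 1)"
        using L0 that by (rule tendstoD)
      then obtain d where "d > 0" "\<forall>z\<in>ball 0 1. z \<noteq> \<zeta>0 \<and> dist z \<zeta>0 < d \<longrightarrow> dist (B z) L0 < e"
        unfolding eventually_at by blast
      then show ?thesis
        using \<zeta>0 by (intro exI[of _ d]) (auto simp: dist_norm norm_minus_commute)
    qed
    \<comment> \<open>Every arc around \<zeta>0 contains the end of a radius outside the null set
      \<open>Z\<close>; its radial limit has modulus 1 and must be close to
      \<open>L0\<close>.\<close>
    have "cmod L0 = 1"
    proof (rule ccontr)
      assume "cmod L0 \<noteq> 1"
      define e where "e = \<bar>cmod L0 - 1\<bar> / 2"
      have e: "e > 0" using \<open>cmod L0 \<noteq> 1\<close> by (simp add: e_def)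
      obtain d where d: "d > 0" "\<And>z. z \<in> ball 0 1 \<Longrightarrow> z \<in> ball \<zeta>0 d \<Longrightarrow> cmod (B z - L0) < e"
        using near[OF e] by blast
      define U where "U = cis -` ball \<zeta>0 d"
      have U: "open U"
        unfolding U_def by (intro open_vimage continuous_intros open_ball)
      obtain x0 where x0: "0 \<le> x0" "x0 < 2*pi" "\<zeta>0 = cis x0"
        by (rule unimodular_eq_cis[of \<zeta>0]) (use \<zeta>0 in auto)
      \<comment> \<open>The angle \<open>x0\<close> may be 0, outside the open interval; being in
        its closure, it still forces the open set \<open>U\<close> to meet that interval, in a set
        of positive measure.\<close>
      then have "x0 \<in> U \<inter> closure {0<..<2*pi}" using d by (simp add: U_def)
      then have "U \<inter> {0<..<2*pi} \<noteq> {}"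
        using open_Int_closure_eq_empty[OF U] by blast
      then have "\<not> negligible (U \<inter> {0<..<2*pi})"
        using U by (intro open_not_negligible open_Int) auto
      then obtain x where x: "x \<in> U \<inter> {0<..<2*pi}" "x \<notin> Z"
        using Z negligible_subset by blast
      then obtain L where L: "cmod L = 1" "((\<lambda>r. B (of_real r * cis x)) \<longlongrightarrow> L) (at_left 1)"
        by (auto simp: Z_def)
      have "((\<lambda>r::real. of_real r * cis x) \<longlongrightarrow> of_real 1 * cis x) (at_left 1)"
        by (intro tendsto_intros)
      then have "eventually (\<lambda>r::real. of_real r * cis x \<in> ball \<zeta>0 d) (at_left 1)"
        by (rule topological_tendstoD) (use x in \<open>auto simp: U_def\<close>)
      moreover have "eventually (\<lambda>r::real. r \<in> {0<..<1}) (at_left 1)"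
        by (rule eventually_at_leftI[of 0]) auto
      ultimately have "eventually (\<lambda>r. cmod (B (of_real r * cis x) - L0) \<le> e) (at_left 1)"
        by eventually_elim (intro less_imp_le d(2), auto simp: norm_mult)
      moreover have "((\<lambda>r. cmod (B (of_real r * cis x) - L0)) \<longlongrightarrow> cmod (L - L0)) (at_left 1)"
        by (intro tendsto_intros L)
      ultimately have "cmod (L - L0) \<le> e"
        by (intro tendsto_upperbound[where F = "at_left (1::real)"]) auto
      moreover have "\<bar>cmod L - cmod L0\<bar> = 2 * e"
        by (simp add: e_def L(1) abs_minus_commute)
      ultimately show False
        using norm_triangle_ineq3[of L L0] e by linarith
    qed
    then obtain d where d: "d > 0" "\<And>z. z \<in> ball 0 1 \<Longrightarrow> z \<in> ball \<zeta>0 d \<Longrightarrow> cmod (B z - L0) < 1"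
      using near[of 1] by auto
    \<comment> \<open>At a zero, \<open>B\<close> is at distance 1 from \<open>L0\<close>, which is
      impossible this close to \<zeta>0.\<close>
    have far: "d \<le> dist (a n) \<zeta>0" if "enat n < N" for n
    proof (rule ccontr)
      assume "\<not> d \<le> dist (a n) \<zeta>0"
      then have "cmod (B (a n) - L0) < 1"
        using a[OF that] by (intro d) (auto simp: dist_commute)
      moreover have "B (a n) = 0" using B_tail[of "a n"] a[OF that] tail_0_zero[OF that] by simp
      ultimately show False using \<open>cmod L0 = 1\<close> by simp
    qed
    have "\<zeta> \<notin> E" if \<zeta>: "\<zeta> \<in> ball \<zeta>0 (d/2) \<inter> sphere 0 1" for \<zeta>
    proof -
      have "d / 2 \<le> dist (a n) \<zeta>" if "enat n < N" for n
        using far[OF that] \<zeta> dist_triangle[of "a n" \<zeta>0 \<zeta>] by (simp add: dist_commute)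
      then obtain L where L: "(tail 0 \<longlongrightarrow> L) (at \<zeta> within ball 0 1)"
        using unrestricted_limit_tail[of \<zeta> "d/2"] \<zeta> d(1) by (auto simp: has_unrestricted_limit_def)
      have "((\<lambda>z. c * z ^ k * tail 0 z) \<longlongrightarrow> c * \<zeta> ^ k * L) (at \<zeta> within ball 0 1)"
        by (intro tendsto_intros L)
      moreover have "eventually (\<lambda>z. c * z ^ k * tail 0 z = B z) (at \<zeta> within ball 0 1)"
        unfolding eventually_at_filter by (simp add: B_tail)
      ultimately have "(B \<longlongrightarrow> c * \<zeta> ^ k * L) (at \<zeta> within ball 0 1)"
        by (rule Lim_transform_eventually)
      then have "has_radial_limit B \<zeta>"
        using \<zeta> by (intro unrestricted_imp_radial_limit) (auto simp: has_unrestricted_limit_def)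
      then show ?thesis using rad by blast
    qed
    then show ?thesis using d(1) by (intro exI[of _ "d/2"]) auto
  qed
  have "openin (top_of_set (sphere 0 1)) (sphere 0 1 - E)"
    unfolding openin_contains_ball using open_compl by fastforce
  then show cl: "closedin (top_of_set (sphere 0 1)) E"
    using E by (simp add: closedin_def)
  have "closed E" using cl closed_sphere by (rule closedin_closed_trans)
  moreover have "{x\<in>{0..2*pi}. cis x \<in> E} \<subseteq> Z"
    unfolding Z_def using rad by (auto simp: has_radial_limit_def)
  then have "negligible {x\<in>{0..2*pi}. cis x \<in> E}" using Z negligible_subset by blast
  ultimately show "emeasure circle_lebesgue E = 0"
    using E by (simp add: emeasure_circle_lebesgue_eq_0_iff)
qed

section \<open>Blaschke products with prescribed singular set\<close>

lemma dist_cis_le: "dist (cis x) (cis y) \<le> \<bar>x - y\<bar>"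
proof -
  have "cis x - cis y = cis y * (cis (x - y) - 1)"
    by (simp add: right_diff_distrib cis_mult)
  then have "dist (cis x) (cis y) = 2 * \<bar>sin ((x - y) / 2)\<bar>"
    using dist_exp_i_1[of "x - y"] by (simp only: dist_norm norm_mult norm_cis mult_1 flip: cis_conv_exp)
  also have "\<dots> \<le> 2 * \<bar>(x - y) / 2\<bar>" by (intro mult_left_mono abs_sin_x_le_abs_x) simp
  finally show ?thesis by simp
qed

text \<open>Outer regularity encloses the angles in an open set of measure at most
  \<open>2 * e / 5\<close>. Disjoint Vitali intervals inside it have half-lengths \<open>r x\<close>
  of sum at most \<open>e / 5\<close>, and their fivefold enlargements cover, so
  \<open>h x = 5 * r x\<close>. The centres lie in \<open>E\<close>, which later keeps the zeros
  from accumulating elsewhere.\<close>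

lemma null_circle_cover:
  assumes E: "closed E" "E \<subseteq> sphere 0 1" and null: "negligible {x\<in>{0..2*pi}. cis x \<in> E}" and e: "e > 0"
  obtains C h where "finite C" "cis ` C \<subseteq> E" "\<And>x. x \<in> C \<Longrightarrow> 0 < h x" "(\<Sum>x\<in>C. h x) \<le> e"
    "\<And>\<zeta>. \<zeta> \<in> E \<Longrightarrow> \<exists>x\<in>C. dist \<zeta> (cis x) \<le> h x"
proof -
  define K where "K = {x\<in>{0..2*pi}. cis x \<in> E}"
  have "closed (cis -` E)"
    using E by (intro closed_vimage) (auto intro!: continuous_intros)
  then have "compact ({0..2*pi} \<inter> cis -` E)" by (intro compact_Int_closed) auto
  moreover have "K = {0..2*pi} \<inter> cis -` E" by (auto simp: K_def)
  ultimately have K: "compact K" by simp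
  have "negligible K" using null by (simp add: K_def)
  then have K0: "K \<in> lmeasurable" "measure lebesgue K = 0"
    using negligible_imp_measurable negligible_imp_measure0 by blast+
  obtain T where T: "open T" "K \<subseteq> T" "T - K \<in> lmeasurable" "emeasure lebesgue (T - K) < ennreal (2 * e / 5)"
    using sets_lebesgue_outer_open[of K "2 * e / 5"] K0 e by (auto simp: fmeasurableD)
  have "T = K \<union> (T - K)" using T(2) by blast
  then have Tm: "T \<in> lmeasurable"
    using fmeasurable.Un[OF K0(1) T(3)] by simp
  have "measure lebesgue T \<le> measure lebesgue K + measure lebesgue (T - K)"
    using \<open>T = K \<union> (T - K)\<close> measure_Un_le[of K lebesgue "T - K"] K0(1) T(3) by (simp add: fmeasurableD)
  also have "\<dots> \<le> 2 * e / 5"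
    using T(3,4) K0 e by (simp add: emeasure_eq_measure2 ennreal_less_iff)
  finally have T_small: "measure lebesgue T \<le> 2 * e / 5" .
  have "\<exists>r>0. ball x r \<subseteq> T" if "x \<in> K" for x
    using T(1,2) that by (meson open_contains_ball subsetD)
  then obtain r where r: "r x > 0" "ball x (r x) \<subseteq> T" if "x \<in> K" for x by metis
  obtain C where C: "finite C" "C \<subseteq> K" "pairwise (\<lambda>x y. disjnt (ball x (r x)) (ball y (r y))) C"
    "K \<subseteq> (\<Union>x\<in>C. ball x (5 * r x))"
    by (rule vitali_compact_real[OF K, of r]) (use r(1) in auto)
  have "(\<Sum>x\<in>C. 2 * r x) = (\<Sum>x\<in>C. measure lebesgue (ball x (r x)))"
    using C r(1) by (intro sum.cong) (auto simp: ball_eq_greaterThanLessThan subset_iff less_imp_le)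
  also have "\<dots> = measure lebesgue (\<Union>x\<in>C. ball x (r x))"
    using C by (intro measure_UNION'[symmetric]) (auto simp: pairwise_def)
  also have "\<dots> \<le> measure lebesgue T"
    using C r(2) Tm by (intro measure_mono_fmeasurable) (auto intro!: sets.finite_UN)
  finally have "(\<Sum>x\<in>C. 5 * r x) \<le> e"
    using T_small by (simp add: sum_distrib_left[symmetric])
  moreover have "\<exists>x\<in>C. dist \<zeta> (cis x) \<le> 5 * r x" if \<zeta>: "\<zeta> \<in> E" for \<zeta>
  proof -
    obtain t where t: "0 \<le> t" "t < 2*pi" "\<zeta> = cis t"
      by (rule unimodular_eq_cis[of \<zeta>]) (use \<zeta> E(2) in auto)
    then have "t \<in> K" using \<zeta> by (simp add: K_def)
    then obtain x where "x \<in> C" "t \<in> ball x (5 * r x)" using C(4) by blast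
    then show ?thesis
      using dist_cis_le[of t x] t(3) by (intro bexI[of _ x]) (auto simp: dist_real_def)
  qed
  ultimately show thesis
    using C r(1) by (intro that[of C "\<lambda>x. 5 * r x"]) (auto simp: K_def)
qed

section \<open>Choosing the zeros in stages\<close>

lemma finite_blaschke_large_radius:
  assumes a: "\<And>n. n < m \<Longrightarrow> a n \<in> ball 0 1 - {0}" and \<delta>: "0 < \<delta>" "\<delta> \<le> (1::real)"
  shows "\<exists>r\<ge>1 - \<delta>. r < 1 \<and> (\<forall>\<zeta>. cmod \<zeta> = 1 \<longrightarrow> 7/8 \<le> cmod (\<Prod>n<m. blaschke_factor (a n) (of_real r * \<zeta>)))"
proof -
  define f where "f z = (\<Prod>n<m. blaschke_factor (a n) z)" for z
  have "continuous_on (cball 0 1) f"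
    unfolding f_def using a
    by (intro continuous_intros holomorphic_on_imp_continuous_on[OF blaschke_factor_holomorphic]) auto
  then have "uniformly_continuous_on (cball 0 1) f"
    by (intro compact_uniformly_continuous) auto
  then obtain d where d: "d > 0" "\<And>z w. z \<in> cball 0 1 \<Longrightarrow> w \<in> cball 0 1 \<Longrightarrow> dist w z < d \<Longrightarrow> dist (f w) (f z) < 1/8"
    unfolding uniformly_continuous_on_def by (metis zero_less_divide_1_iff zero_less_numeral)
  \<comment> \<open>The finite product has modulus 1 on the unit circle, so by uniform continuity a
    circle closer than \<open>d\<close> costs at most 1/8; the other entry of the maximum places it
    beyond \<open>1 - \<delta>\<close>.\<close>
  define r where "r = max (1 - \<delta>) (1 - d/2)"
  have r: "1 - \<delta> \<le> r" "r < 1" "0 \<le> r" "1 - r < d" using d \<delta> by (auto simp: r_def)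
  show ?thesis
  proof (intro exI[of _ r] conjI r allI impI)
    fix \<zeta> :: complex assume \<zeta>: "cmod \<zeta> = 1"
    have "of_real r * \<zeta> - \<zeta> = - (of_real (1 - r) * \<zeta>)" by (simp add: algebra_simps)
    then have "dist (of_real r * \<zeta>) \<zeta> = 1 - r"
      using r \<zeta> unfolding dist_norm by (simp only: norm_minus_cancel norm_mult norm_of_real) simp
    then have "dist (f (of_real r * \<zeta>)) (f \<zeta>) < 1/8"
      using r \<zeta> by (intro d(2)) (auto simp: norm_mult)
    moreover have "cmod (f \<zeta>) = 1"
      unfolding f_def prod_norm[symmetric] using a \<zeta> by (simp add: norm_blaschke_factor_eq_1)
    ultimately show "7/8 \<le> cmod (\<Prod>n<m. blaschke_factor (a n) (of_real r * \<zeta>))"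
      using norm_triangle_ineq2[of "f \<zeta>" "f (of_real r * \<zeta>)"]
      by (simp add: dist_norm norm_minus_commute f_def)
  qed
qed

text \<open>
  In \<open>(m, a, e)\<close>, the zeros \<open>a 0, \<dots>, a (m - 1)\<close> have been chosen and \<open>e\<close> bounds the sum of
  \<open>1 - \<bar>a n\<bar>\<close> over all zeros still to come. The condition \<open>16 e \<le> 1 - r\<close> makes their product at least
  \<open>7/8\<close> on the circle of radius \<open>r\<close>.
\<close>

definition stage :: "nat \<Rightarrow> nat \<times> (nat \<Rightarrow> complex) \<times> real \<Rightarrow> bool" where
  "stage j = (\<lambda>(m, a, e). j \<le> m \<and> (\<forall>n<m. a n \<in> ball 0 1 - {0}) \<and> 0 < e \<and> e \<le> (1/2) ^ Suc j \<and>
     (\<exists>r. 1 - (1/2) ^ j \<le> r \<and> r < 1 \<and> 16 * e \<le> 1 - r \<and>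
       (\<forall>\<zeta>. cmod \<zeta> = 1 \<longrightarrow> 7/8 \<le> cmod (\<Prod>n<m. blaschke_factor (a n) (of_real r * \<zeta>)))))"

text \<open>The budget \<open>e\<close> is split in two halves, one for the new zeros and one for
  all later ones. Directions in \<open>E\<close> confine accumulation to \<open>E\<close>; the last
  clause puts some new zero at least as far from the circle as its direction is from the given point
  of \<open>E\<close>, which makes its factor small on that radius.\<close>

definition refines :: "complex set \<Rightarrow> nat \<times> (nat \<Rightarrow> complex) \<times> real \<Rightarrow> nat \<times> (nat \<Rightarrow> complex) \<times> real \<Rightarrow> bool" where
  "refines E = (\<lambda>(m, a, e) (m', a', e'). m < m' \<and> (\<forall>n<m. a' n = a n) \<and> e' \<le> e / 2 \<and>
     (\<Sum>n\<in>{m..<m'}. 1 - cmod (a' n)) \<le> e / 2 \<and>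
     (\<forall>n\<in>{m..<m'}. sgn (a' n) \<in> E) \<and>
     (\<forall>\<zeta>\<in>E. \<exists>n\<in>{m..<m'}. dist \<zeta> (sgn (a' n)) \<le> 1 - cmod (a' n)))"

text \<open>The empty product is 1 even on the circle of radius 0, for which 1/16 is the largest
  admissible budget.\<close>

lemma stage_0: "stage 0 (0, \<lambda>_. 0, 1/16)"
  by (auto simp: stage_def intro!: exI[of _ 0])

lemma stage_refine:
  assumes E: "closed E" "E \<subseteq> sphere 0 1" "E \<noteq> {}" and null: "negligible {x\<in>{0..2*pi}. cis x \<in> E}"
    and st: "stage j (m, a, e)"
  shows "\<exists>s. stage (Suc j) s \<and> refines E (m, a, e) s"
proof -
  have e: "0 < e" "e \<le> (1/2) ^ Suc j" and a: "\<And>n. n < m \<Longrightarrow> a n \<in> ball 0 1 - {0}" and jm: "j \<le> m"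
    using st by (auto simp: stage_def)
  have "(1/2::real) ^ Suc j \<le> 1/2" by (simp add: power_le_one)
  with e have e1: "e \<le> 1/2" by linarith
  obtain C h where C: "finite C" "cis ` C \<subseteq> E" "\<And>x. x \<in> C \<Longrightarrow> 0 < h x" "(\<Sum>x\<in>C. h x) \<le> e / 2"
    "\<And>\<zeta>. \<zeta> \<in> E \<Longrightarrow> \<exists>x\<in>C. dist \<zeta> (cis x) \<le> h x"
    using null_circle_cover[OF E(1,2) null, of "e/2"] e by (metis half_gt_zero)
  obtain b where b: "bij_betw b {0..<card C} C" using ex_bij_betw_nat_finite[OF C(1)] by blast
  define m' where "m' = m + card C"
  define a' where "a' n = (if n < m then a n else of_real (1 - h (b (n - m))) * cis (b (n - m)))" for n
  \<comment> \<open>A nonempty \<open>E\<close> forces at least one new zero, so the stages exhaust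
    all indices.\<close>
  have "C \<noteq> {}" using C(5) E(3) by blast
  then have mm': "m < m'" using C(1) by (simp add: m'_def card_gt_0_iff)
  \<comment> \<open>The heights sum to at most \<open>e / 2 \<le> 1/4\<close>; this keeps the new
    zeros away from the origin.\<close>
  have h: "h x \<le> 1/4" if "x \<in> C" for x
    using member_le_sum[of x C h] C that e1 by (force simp: less_imp_le)
  have bij: "bij_betw (\<lambda>n. b (n - m)) {m..<m'} C"
  proof -
    have "bij_betw (\<lambda>n. n - m) {m..<m'} {0..<card C}"
      by (rule bij_betw_byWitness[where f' = "\<lambda>n. n + m"]) (auto simp: m'_def)
    from bij_betw_trans[OF this b] show ?thesis by (simp add: comp_def)
  qed
  have new: "cmod (a' n) = 1 - h (b (n - m))" "sgn (a' n) = cis (b (n - m))" "b (n - m) \<in> C"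
    if "n \<in> {m..<m'}" for n
  proof -
    show x: "b (n - m) \<in> C" using bij that by (auto dest: bij_betwE)
    have pos: "1 - h (b (n - m)) > 0" using h[OF x] by simp
    then show 1: "cmod (a' n) = 1 - h (b (n - m))"
      using that by (simp add: a'_def norm_mult del: of_real_diff)
    show "sgn (a' n) = cis (b (n - m))"
      unfolding sgn_div_norm 1 using that pos
      by (simp add: a'_def scaleR_conv_of_real del: of_real_diff)
  qed
  have a'_ball: "a' n \<in> ball 0 1 - {0}" if "n < m'" for n
  proof (cases "n < m")
    case True
    then show ?thesis using a by (simp add: a'_def)
  next
    case False
    then have n: "n \<in> {m..<m'}" using that by simp
    have "cmod (a' n) < 1" "cmod (a' n) > 0"
      using new[OF n] C(3) h[of "b (n - m)"] by auto
    then show ?thesis by auto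
  qed
  have pow: "(0::real) < (1/2) ^ Suc j" "(1/2::real) ^ Suc j \<le> 1"
    by (simp, rule power_le_one) auto
  have "\<exists>r\<ge>1 - (1/2) ^ Suc j. r < 1 \<and> (\<forall>\<zeta>. cmod \<zeta> = 1 \<longrightarrow>
      7/8 \<le> cmod (\<Prod>n<m'. blaschke_factor (a' n) (of_real r * \<zeta>)))"
    by (rule finite_blaschke_large_radius) (fact a'_ball pow)+
  then obtain r where r: "1 - (1/2) ^ Suc j \<le> r" "r < 1"
      "\<And>\<zeta>. cmod \<zeta> = 1 \<Longrightarrow> 7/8 \<le> cmod (\<Prod>n<m'. blaschke_factor (a' n) (of_real r * \<zeta>))"
    by blast
  \<comment> \<open>The new budget is fixed only after the circle: later zeros must be too close to
    the boundary to affect the product on radius \<open>r\<close>.\<close>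
  define e' where "e' = min (e / 2) ((1 - r) / 16)"
  have e': "0 < e'" "e' \<le> e / 2" "16 * e' \<le> 1 - r"
    using e r(2) by (auto simp: e'_def min_def)
  have "stage (Suc j) (m', a', e')"
    unfolding stage_def
    using a'_ball r e e' mm' jm by (auto intro!: exI[of _ r])
  moreover have "refines E (m, a, e) (m', a', e')"
  proof -
    have "(\<Sum>n\<in>{m..<m'}. 1 - cmod (a' n)) = (\<Sum>n\<in>{m..<m'}. h (b (n - m)))"
      by (intro sum.cong) (auto simp: new)
    also have "\<dots> = (\<Sum>x\<in>C. h x)"
      using sum.reindex_bij_betw[OF bij, of h] by simp
    finally have 1: "(\<Sum>n\<in>{m..<m'}. 1 - cmod (a' n)) \<le> e / 2" using C(4) by simp
    have 2: "\<exists>n\<in>{m..<m'}. dist \<zeta> (sgn (a' n)) \<le> 1 - cmod (a' n)" if \<zeta>: "\<zeta> \<in> E" for \<zeta>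
    proof -
      obtain x where x: "x \<in> C" "dist \<zeta> (cis x) \<le> h x" using C(5)[OF \<zeta>] by blast
      then have "x \<in> (\<lambda>n. b (n - m)) ` {m..<m'}" using bij by (simp add: bij_betw_def)
      then obtain n where n: "n \<in> {m..<m'}" "x = b (n - m)" by blast
      then have "dist \<zeta> (sgn (a' n)) \<le> 1 - cmod (a' n)" using new[OF n(1)] x(2) by simp
      then show ?thesis using n(1) by blast
    qed
    show ?thesis
      unfolding refines_def prod.case
    proof (intro conjI)
      show "\<forall>n<m. a' n = a n" by (simp add: a'_def)
      show "\<forall>n\<in>{m..<m'}. sgn (a' n) \<in> E" using new(2,3) C(2) by auto
      show "\<forall>\<zeta>\<in>E. \<exists>n\<in>{m..<m'}. dist \<zeta> (sgn (a' n)) \<le> 1 - cmod (a' n)" using 2 by blast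
    qed (fact mm' 1 e'(2))+
  qed
  ultimately show ?thesis by blast
qed

text \<open>Dependent choice iterates \<open>stage_refine\<close>; each stage preserves the earlier
  zeros, so the finite lists merge into one sequence. Starting with \<open>m 0 = 0\<close> makes the
  blocks cover every index.\<close>

lemma blaschke_sequence_exists:
  assumes E: "closed E" "E \<subseteq> sphere 0 1" "E \<noteq> {}" and null: "negligible {x\<in>{0..2*pi}. cis x \<in> E}"
  obtains a m e where "\<And>n. a n \<in> ball 0 1 - {0}" "\<And>n. sgn (a n) \<in> E"
    "\<And>j M. (\<Sum>n\<in>{m j..<M}. 1 - cmod (a n)) \<le> e j" "\<And>j. e j \<le> (1/2) ^ Suc j" "m 0 = (0::nat)"
    "\<And>j. \<exists>r. 1 - (1/2) ^ j \<le> r \<and> r < 1 \<and> 16 * e j \<le> 1 - r \<and>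
       (\<forall>\<zeta>. cmod \<zeta> = 1 \<longrightarrow> 7/8 \<le> cmod (\<Prod>n<m j. blaschke_factor (a n) (of_real r * \<zeta>)))"
    "\<And>j \<zeta>. \<zeta> \<in> E \<Longrightarrow> \<exists>n\<ge>m j. dist \<zeta> (sgn (a n)) \<le> 1 - cmod (a n)"
proof -
  have "\<exists>f. \<forall>n. (stage n (f n) \<and> (n = 0 \<longrightarrow> fst (f n) = 0)) \<and> refines E (f n) (f (Suc n))"
  proof (rule dependent_nat_choice[where P = "\<lambda>n s. stage n s \<and> (n = 0 \<longrightarrow> fst s = 0)" and Q = "\<lambda>_. refines E"])
    show "\<exists>s. stage 0 s \<and> ((0::nat) = 0 \<longrightarrow> fst s = 0)"
      using stage_0 by (intro exI[of _ "(0, \<lambda>_. 0, 1/16)"]) simp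
    show "\<exists>t. (stage (Suc n) t \<and> (Suc n = 0 \<longrightarrow> fst t = 0)) \<and> refines E s t"
      if "stage n s \<and> (n = 0 \<longrightarrow> fst s = 0)" for s n
      using stage_refine[OF E null, of n "fst s" "fst (snd s)" "snd (snd s)"] that by simp
  qed
  then obtain f where f: "\<And>j. stage j (f j)" "fst (f 0) = 0" "\<And>j. refines E (f j) (f (Suc j))" by blast
  define m where "m j = fst (f j)" for j
  define b where "b j = fst (snd (f j))" for j
  define e where "e j = snd (snd (f j))" for j
  have feq: "f j = (m j, b j, e j)" for j by (simp add: m_def b_def e_def)
  note st = f(1)[unfolded feq stage_def, simplified]
  note rf = f(3)[unfolded feq refines_def, simplified]
  have mono_m: "strict_mono m" using rf by (simp add: strict_mono_Suc_iff)
  have stable: "b (j + k) n = b j n" if "n < m j" for j k n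
  proof (induction k)
    case (Suc k)
    have "n < m (j + k)"
      using that strict_mono_less_eq[OF mono_m, of j "j + k"] by simp
    then show ?case using Suc rf[of "j + k"] by simp
  qed simp
  \<comment> \<open>Stage \<open>Suc n\<close> has already fixed the entry \<open>n\<close>, because
    a stage \<open>j\<close> has at least \<open>j\<close> zeros.\<close>
  define a where "a n = b (Suc n) n" for n
  have nm: "n < m (Suc n)" for n using st[of "Suc n"] by simp
  have a_b: "a n = b j n" if "n < m j" for j n
    using stable[OF that, of "Suc n"] stable[OF nm, of n j] by (simp add: a_def add.commute)
  have "a n \<in> ball 0 1 - {0}" for n using st[of "Suc n"] nm[of n] by (simp add: a_def)
  moreover have "\<exists>n\<ge>m j. dist \<zeta> (sgn (a n)) \<le> 1 - cmod (a n)" if "\<zeta> \<in> E" for j \<zeta>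
  proof -
    have "\<exists>n\<in>{m j..<m (Suc j)}. dist \<zeta> (sgn (b (Suc j) n)) \<le> 1 - cmod (b (Suc j) n)"
      using rf[of j] that by blast
    then obtain n where "n \<in> {m j..<m (Suc j)}" "dist \<zeta> (sgn (b (Suc j) n)) \<le> 1 - cmod (b (Suc j) n)"
      by blast
    then show ?thesis using a_b[of n "Suc j"] by auto
  qed
  moreover have "sgn (a n) \<in> E" for n
  proof -
    have "\<exists>j. n \<in> {m j..<m (Suc j)}"
    proof -
      define j where "j = (LEAST j. n < m j)"
      have j: "n < m j" unfolding j_def by (rule LeastI[of _ "Suc n"]) (rule nm)
      have "j \<noteq> 0" using j f(2) by (auto simp: m_def intro: ccontr)
      then obtain i where i: "j = Suc i" by (cases j) auto
      then have "\<not> n < m i" using not_less_Least[of i "\<lambda>j. n < m j"] by (simp add: j_def[symmetric])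
      then show ?thesis using i j by (intro exI[of _ i]) auto
    qed
    then obtain j where "n \<in> {m j..<m (Suc j)}" by blast
    then show ?thesis using rf[of j] a_b[of n "Suc j"] by auto
  qed
  moreover have "(\<Sum>n\<in>{m j..<M}. 1 - cmod (a n)) \<le> e j" for j M
  proof -
    \<comment> \<open>Telescoping: a block costs at most half the current budget, and the next
      budget is at most the other half.\<close>
    have 1: "(\<Sum>n\<in>{m j..<m (j + k)}. 1 - cmod (a n)) \<le> e j - e (j + k)" for k
    proof (induction k)
      case (Suc k)
      have "(\<Sum>n\<in>{m (j + k)..<m (Suc (j + k))}. 1 - cmod (a n)) =
          (\<Sum>n\<in>{m (j + k)..<m (Suc (j + k))}. 1 - cmod (b (Suc (j + k)) n))"
        by (intro sum.cong) (auto simp: a_b)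
      also have "\<dots> \<le> e (j + k) / 2" using rf[of "j + k"] by simp
      also have "\<dots> \<le> e (j + k) - e (Suc (j + k))" using rf[of "j + k"] by simp
      finally have "(\<Sum>n\<in>{m (j + k)..<m (Suc (j + k))}. 1 - cmod (a n)) \<le> e (j + k) - e (Suc (j + k))" .
      moreover have "m j \<le> m (j + k)" "m (j + k) \<le> m (Suc (j + k))"
        using strict_mono_less_eq[OF mono_m] by auto
      then have "(\<Sum>n\<in>{m j..<m (j + k)}. 1 - cmod (a n)) + (\<Sum>n\<in>{m (j + k)..<m (Suc (j + k))}. 1 - cmod (a n)) =
          (\<Sum>n\<in>{m j..<m (Suc (j + k))}. 1 - cmod (a n))"
        by (rule sum.atLeastLessThan_concat)
      ultimately show ?case using Suc.IH by simp
    qed simp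
    have "M \<le> m (j + M)" using st[of "j + M"] by simp
    then have "(\<Sum>n\<in>{m j..<M}. 1 - cmod (a n)) \<le> (\<Sum>n\<in>{m j..<m (j + M)}. 1 - cmod (a n))"
      using \<open>\<And>n. a n \<in> ball 0 1 - {0}\<close> by (intro sum_mono2) (auto simp: less_imp_le)
    also have "\<dots> \<le> e j" using 1[of M] st[of "j + M"] by simp
    finally show ?thesis .
  qed
  moreover have "\<exists>r. 1 - (1/2) ^ j \<le> r \<and> r < 1 \<and> 16 * e j \<le> 1 - r \<and>
       (\<forall>\<zeta>. cmod \<zeta> = 1 \<longrightarrow> 7/8 \<le> cmod (\<Prod>n<m j. blaschke_factor (a n) (of_real r * \<zeta>)))" for j
  proof -
    have "(\<Prod>n<m j. blaschke_factor (a n) z) = (\<Prod>n<m j. blaschke_factor (b j n) z)" for z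
      by (intro prod.cong) (auto simp: a_b)
    then show ?thesis using st[of j] by simp
  qed
  moreover have "e j \<le> (1/2) ^ Suc j" for j using st[of j] by simp
  moreover have "m 0 = 0" using f(2) by (simp add: m_def)
  ultimately show thesis by (intro that) 
qed

section \<open>Oscillation along radii and regularity elsewhere\<close>

lemma radial_limit_along:
  fixes s :: "nat \<Rightarrow> real"
  assumes L: "((\<lambda>r. f (of_real r * \<zeta>)) \<longlongrightarrow> L) (at_left 1)"
    and s: "\<And>j. 1 - (1/2) ^ j \<le> s j" "\<And>j. s j < 1"
  shows "(\<lambda>j. f (of_real (s j) * \<zeta>)) \<longlonglongrightarrow> L"
proof -
  have "s \<longlonglongrightarrow> 1"
  proof (rule tendsto_sandwich)
    have "(\<lambda>j. 1 - (1/2::real) ^ j) \<longlonglongrightarrow> 1 - 0"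
      by (intro tendsto_intros LIMSEQ_realpow_zero) auto
    then show "(\<lambda>j. 1 - (1/2::real) ^ j) \<longlonglongrightarrow> 1" by simp
    show "(\<lambda>j. 1::real) \<longlonglongrightarrow> 1" by simp
  qed (auto intro!: always_eventually less_imp_le s)
  then have "filterlim s (at_left 1) sequentially"
    using s by (auto simp: filterlim_at less_imp_neq)
  from filterlim_compose[OF L this] show ?thesis by simp
qed

lemma blaschke_product_sufficient:
  assumes E: "closed E" "E \<subseteq> sphere 0 1" "E \<noteq> {}" and null: "negligible {x\<in>{0..2*pi}. cis x \<in> E}"
  obtains B where "blaschke_product B" "\<And>\<zeta>. \<zeta> \<in> E \<Longrightarrow> \<not> has_radial_limit B \<zeta>"
    "\<And>\<zeta>. \<zeta> \<in> sphere 0 1 - E \<Longrightarrow> has_unrestricted_limit B \<zeta>"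
proof -
  obtain a m e where a: "\<And>n. a n \<in> ball 0 1 - {0}" "\<And>n. sgn (a n) \<in> E"
    and sums: "\<And>j M. (\<Sum>n\<in>{m j..<M}. 1 - cmod (a n)) \<le> e j" and e: "\<And>j. e j \<le> (1/2) ^ Suc j" and m0: "m 0 = (0::nat)"
    and large: "\<And>j. \<exists>r. 1 - (1/2) ^ j \<le> r \<and> r < 1 \<and> 16 * e j \<le> 1 - r \<and>
       (\<forall>\<zeta>. cmod \<zeta> = 1 \<longrightarrow> 7/8 \<le> cmod (\<Prod>n<m j. blaschke_factor (a n) (of_real r * \<zeta>)))"
    and near: "\<And>j \<zeta>. \<zeta> \<in> E \<Longrightarrow> \<exists>n\<ge>m j. dist \<zeta> (sgn (a n)) \<le> 1 - cmod (a n)"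
    by (rule blaschke_sequence_exists[OF E null]) blast
  have sm: "summable (\<lambda>n. 1 - cmod (a n))"
    using a(1) sums[of 0] m0
    by (intro summableI_nonneg_bounded[where x = "e 0"]) (auto simp: less_imp_le atLeast0LessThan)
  interpret blaschke_sequence a \<infinity>
    by unfold_locales (rule a(1), simp add: sm)
  have fac_eq: "fac n z = blaschke_factor (a n) z" and gap_eq: "gap n = 1 - cmod (a n)" for n z
    by (simp_all add: fac_def gap_def)
  have "blaschke_product (tail 0)"
    unfolding blaschke_product_def
    using a(1) sm
    by (intro exI[of _ "1::complex"] exI[of _ "0::nat"] exI[of _ \<infinity>] exI[of _ a]) (auto simp: tail_def fac_def)
  moreover have "\<not> has_radial_limit (tail 0) \<zeta>" if \<zeta>: "\<zeta> \<in> E" for \<zeta>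
  proof
    assume "has_radial_limit (tail 0) \<zeta>"
    then obtain L where L: "((\<lambda>r. tail 0 (of_real r * \<zeta>)) \<longlongrightarrow> L) (at_left 1)"
      by (auto simp: has_radial_limit_def)
    have \<zeta>1: "cmod \<zeta> = 1" using \<zeta> E(2) by auto
    obtain r where r: "\<And>j. 1 - (1/2) ^ j \<le> r j" "\<And>j. r j < 1" "\<And>j. 16 * e j \<le> 1 - r j"
      "\<And>j. 7/8 \<le> cmod (\<Prod>n<m j. blaschke_factor (a n) (of_real (r j) * \<zeta>))"
      using large \<zeta>1 by metis
    \<comment> \<open>On the circle of stage \<open>j\<close> the zeros chosen so far contribute at
      least 7/8 and the remaining ones at least another 7/8.\<close>
    have lower: "49/64 \<le> cmod (tail 0 (of_real (r j) * \<zeta>))" for j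
    proof -
      have "(1/2::real) ^ j \<le> 1" by (simp add: power_le_one)
      then have "0 \<le> r j" using r(1)[of j] by linarith
      then have nz: "cmod (of_real (r j) * \<zeta>) = r j" using \<zeta>1 by (simp add: norm_mult)
      then have lt: "cmod (of_real (r j) * \<zeta>) < 1" using r(2)[of j] by (simp only:)
      have "1 - 2 / (1 - r j) * e j \<le> cmod (tail (m j) (of_real (r j) * \<zeta>))"
        using tail_lower_bound[OF lt, of "m j" "e j"] sums[of j] unfolding nz gap_eq by blast
      moreover have "2 / (1 - r j) * e j \<le> 1/8"
        using r(2,3)[of j] by (simp add: field_simps)
      ultimately have "7/8 \<le> cmod (tail (m j) (of_real (r j) * \<zeta>))" by linarith
      then have "7/8 * (7/8) \<le> cmod (\<Prod>n<m j. blaschke_factor (a n) (of_real (r j) * \<zeta>)) * cmod (tail (m j) (of_real (r j) * \<zeta>))"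
        using r(4)[of j] by (intro mult_mono) auto
      also have "\<dots> = cmod (tail 0 (of_real (r j) * \<zeta>))"
        using tail_split[OF lt, of "m j"] by (simp only: fac_eq norm_mult)
      finally show ?thesis by simp
    qed
    have "(\<lambda>j. cmod (tail 0 (of_real (r j) * \<zeta>))) \<longlonglongrightarrow> cmod L"
      by (intro tendsto_norm radial_limit_along[OF L] r)
    then have "49/64 \<le> cmod L"
      using lower by (intro LIMSEQ_le_const) auto
    moreover have "cmod L \<le> 2/3"
    proof -
      obtain n where n: "\<And>j. m j \<le> n j" "\<And>j. dist \<zeta> (sgn (a (n j))) \<le> 1 - cmod (a (n j))"
        using near[OF \<zeta>] by metis
      have small: "1 - cmod (a (n j)) \<le> (1/2) ^ Suc j" for j
      proof -
        have "1 - cmod (a (n j)) \<le> (\<Sum>i\<in>{m j..<Suc (n j)}. 1 - cmod (a i))"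
          using n(1)[of j] a(1) by (intro member_le_sum) (auto simp: less_imp_le)
        then show ?thesis using sums[of j "Suc (n j)"] e[of j] by linarith
      qed
      \<comment> \<open>At the point of the radius with the modulus \<open>s\<close> of the zero,
        the numerator of its factor is at most 1 - s and the denominator at least 1 - s^2. The
        quotient is at most 1 / (1 + s), hence at most 2/3 because
        \<open>s \<ge> 1/2\<close>.\<close>
      have upper: "cmod (tail 0 (of_real (cmod (a (n j))) * \<zeta>)) \<le> 2/3" for j
      proof -
        define b where "b = a (n j)"
        define s where "s = cmod b"
        define D where "D = cmod (1 - cnj b * (of_real s * \<zeta>))"
        have "(1/2::real) ^ Suc j \<le> 1/2" by (simp add: power_le_one)
        then have s: "1 \<le> 2 * s" "0 < s" "s < 1"
          using small[of j] a(1)[of "n j"] by (simp_all add: s_def b_def)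
        have "b - of_real s * \<zeta> = of_real s * (sgn b - \<zeta>)"
          using s by (simp add: s_def sgn_div_norm scaleR_conv_of_real algebra_simps)
        then have "cmod (b - of_real s * \<zeta>) = s * dist \<zeta> (sgn b)"
          using s by (simp add: norm_mult dist_norm norm_minus_commute)
        also have "\<dots> \<le> dist \<zeta> (sgn b)"
          using s by (intro mult_left_le_one_le) auto
        finally have 1: "cmod (b - of_real s * \<zeta>) \<le> 1 - s"
          using n(2)[of j] unfolding s_def b_def by linarith
        have "3 * (1 - s) \<le> 2 * (1 + s) * (1 - s)" using s by (intro mult_right_mono) auto
        then have "3 - 3 * s \<le> 2 * (1 + s) * (1 - s)" by (simp only: right_diff_distrib mult_1_right)
        also have "\<dots> = 2 * (1 - cmod (cnj b * (of_real s * \<zeta>)))"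
          using \<zeta>1 s by (simp add: norm_mult s_def[symmetric] algebra_simps)
        also have "\<dots> \<le> 2 * D"
          using norm_triangle_ineq2[of 1 "cnj b * (of_real s * \<zeta>)"] by (simp add: D_def)
        finally have 2: "3 - 3 * s \<le> 2 * D" .
        then have "D > 0" using s by linarith
        moreover have "3 * cmod (b - of_real s * \<zeta>) \<le> 2 * D" using 1 2 by linarith
        ultimately have "cmod (b - of_real s * \<zeta>) / D \<le> 2/3" by (simp add: pos_divide_le_eq)
        then have "cmod (fac (n j) (of_real s * \<zeta>)) \<le> 2/3"
          using a(1)[of "n j"] unfolding fac_eq b_def[symmetric] by (simp add: norm_blaschke_factor D_def)
        moreover have "cmod (of_real s * \<zeta>) < 1"
          using s \<zeta>1 by (simp add: norm_mult)
        ultimately show ?thesis using norm_tail_0_le_fac order_trans unfolding s_def b_def by blast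
      qed
      have "1 - (1/2) ^ j \<le> cmod (a (n j))" for j
      proof -
        have "(1/2::real) ^ Suc j \<le> (1/2) ^ j" by simp
        then show ?thesis using small[of j] by linarith
      qed
      moreover have "cmod (a (n j)) < 1" for j using a(1)[of "n j"] by simp
      ultimately have "(\<lambda>j. cmod (tail 0 (of_real (cmod (a (n j))) * \<zeta>))) \<longlonglongrightarrow> cmod L"
        by (intro tendsto_norm radial_limit_along[OF L])
      then show ?thesis using upper by (intro LIMSEQ_le_const2) auto
    qed
    ultimately show False by simp
  qed
  moreover have "has_unrestricted_limit (tail 0) \<zeta>" if \<zeta>: "\<zeta> \<in> sphere 0 1 - E" for \<zeta>
  proof -
    have "open (- E)" "\<zeta> \<in> - E" using E(1) \<zeta> by auto
    then obtain d where d: "d > 0" "ball \<zeta> d \<subseteq> - E" by (rule openE)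
    have "(\<lambda>n. 1 - cmod (a n)) \<longlonglongrightarrow> 0" by (rule summable_LIMSEQ_zero[OF sm])
    then have "eventually (\<lambda>n. 1 - cmod (a n) < d/2) sequentially"
      using d(1) by (intro order_tendstoD(2)) auto
    then obtain M where M: "\<And>n. n \<ge> M \<Longrightarrow> 1 - cmod (a n) < d/2"
      by (auto simp: eventually_sequentially)
    \<comment> \<open>The first \<open>M\<close> zeros have a positive least distance to \<zeta>. A
      later zero is within \<open>d/2\<close> of its direction, a point of \<open>E\<close> at
      distance at least \<open>d\<close> from \<zeta>, so \<open>d/2\<close> remains.\<close>
    define d' where "d' = Min (insert (d/2) ((\<lambda>n. dist (a n) \<zeta>) ` {..<M}))"
    have "cmod (a n) \<noteq> cmod \<zeta>" for n using a(1)[of n] \<zeta> by simp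
    then have "a n \<noteq> \<zeta>" for n by metis
    then have "d' > 0"
      unfolding d'_def using d(1) by (subst Min_gr_iff) auto
    moreover have "d' \<le> dist (a n) \<zeta>" for n
    proof (cases "n < M")
      case True
      then show ?thesis unfolding d'_def by (intro Min_le) auto
    next
      case False
      have "a n - sgn (a n) = - (of_real (1 - cmod (a n)) * sgn (a n))"
        using a(1)[of n] by (simp add: sgn_div_norm scaleR_conv_of_real algebra_simps)
      then have "dist (a n) (sgn (a n)) = 1 - cmod (a n)"
        using a(1)[of n] unfolding dist_norm
        by (simp only: norm_minus_cancel norm_mult norm_of_real) (simp add: norm_sgn)
      moreover have "d \<le> dist (sgn (a n)) \<zeta>"
        using a(2)[of n] d(2) by (force simp: dist_commute)
      ultimately have "d/2 \<le> dist (a n) \<zeta>"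
        using M[of n] False dist_triangle[of "sgn (a n)" \<zeta> "a n"] by (simp add: dist_commute)
      moreover have "d' \<le> d/2" unfolding d'_def by (intro Min_le) auto
      ultimately show ?thesis by linarith
    qed
    ultimately show ?thesis using \<zeta> by (intro unrestricted_limit_tail) auto
  qed
  ultimately show thesis by (intro that)
qed

theorem theorem1:
  fixes E :: "complex set"
  assumes "E \<subseteq> sphere 0 1"
  shows "(\<exists>B. blaschke_product B \<and>
            (\<forall>\<zeta>\<in>E. \<not> has_radial_limit B \<zeta>) \<and>
            (\<forall>\<zeta>\<in>sphere 0 1 - E. has_unrestricted_limit B \<zeta>))
       \<longleftrightarrow> closedin (top_of_set (sphere 0 1)) E \<and> emeasure circle_lebesgue E = 0"
proof
  assume "\<exists>B. blaschke_product B \<and> (\<forall>\<zeta>\<in>E. \<not> has_radial_limit B \<zeta>) \<and>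
    (\<forall>\<zeta>\<in>sphere 0 1 - E. has_unrestricted_limit B \<zeta>)"
  then show "closedin (top_of_set (sphere 0 1)) E \<and> emeasure circle_lebesgue E = 0"
    using blaschke_product_necessary[OF assms] by blast
next
  assume R: "closedin (top_of_set (sphere 0 1)) E \<and> emeasure circle_lebesgue E = 0"
  show "\<exists>B. blaschke_product B \<and> (\<forall>\<zeta>\<in>E. \<not> has_radial_limit B \<zeta>) \<and>
    (\<forall>\<zeta>\<in>sphere 0 1 - E. has_unrestricted_limit B \<zeta>)"
  \<comment> \<open>For empty \<open>E\<close> the staged construction would add no zeros; the empty
    Blaschke product, constantly 1, serves instead.\<close>
  proof (cases "E = {}")
    case True
    have "blaschke_product (\<lambda>_. 1)"
      unfolding blaschke_product_def
      by (intro exI[of _ "1::complex"] exI[of _ "0::nat"] exI[of _ "0::enat"]) (auto simp: zero_enat_def)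
    moreover have "has_unrestricted_limit (\<lambda>_. 1) \<zeta>" for \<zeta>
      unfolding has_unrestricted_limit_def by (intro exI[of _ 1] tendsto_const)
    ultimately show ?thesis using True by blast
  next
    case False
    have cl: "closed E" using R closed_sphere closedin_closed_trans by blast
    then have "negligible {x\<in>{0..2*pi}. cis x \<in> E}"
      using R assms by (simp add: emeasure_circle_lebesgue_eq_0_iff)
    from blaschke_product_sufficient[OF cl assms False this] show ?thesis by metis
  qed
qed

end
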